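(* Let $\mathcal{P}$ be an ADP problem where every ADP in $\mathcal{P}$ has the form $\ell\to\{1:r\}^m$. Let $\mathrm{dp}(\mathcal{P})=\{\ell^\#\to t^\#\mid\ell\to\{1:r\}^m\in\mathcal{P},\ t\trianglelefteq_\# r\}$ and $\mathrm{np}(\mathcal{P})=\{\ell\to\flat(r)\mid\ell\to\{1:r\}^{\mathsf{true}}\in\mathcal{P}\}$. (i) $\mathcal{P}$ is $\mathtt{AST}$ if and only if the non-probabilistic DP problem $(\mathrm{dp}(\mathcal{P}),\mathrm{np}(\mathcal{P}))$ is terminating. So the processor $\mathrm{Proc}_{\mathtt{PR}}(\mathcal{P})=\emptyset$ is sound and complete for $\mathtt{AST}$ iff $(\mathrm{dp}(\mathcal{P}),\mathrm{np}(\mathcal{P}))$ is terminating. (ii) Similarly, for every basic ADP problem $(\mathcal{I},\mathcal{P})$ with this second component $\mathcal{P}$: $(\mathcal{I},\mathcal{P})$ is $\mathtt{bAST}$ if $(\mathrm{dp}(\mathcal{P}),\mathrm{np}(\mathcal{P}))$ is terminating. So $\mathrm{Proc}_{\mathtt{PR}}(\mathcal{I},\mathcal{P})=\emptyset$ is sound and complete for $\mathtt{bAST}$ if $(\mathrm{dp}(\mathcal{P}),\mathrm{np}(\mathcal{P}))$ is terminating.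
   Context: **Terms and annotations.** $\Sigma$ is a finite signature, $\mathcal{V}$ a set of variables, $\mathcal{T}=\mathcal{T}(\Sigma,\mathcal{V})$. $\mathcal{D}\subseteq\Sigma$ is the set of defined symbols, i.e., root symbols of left-hand sides of the ADPs under consideration (those in $\mathcal{P}$, resp. $\mathcal{I}\cup\mathcal{P}$), and $\mathcal{C}=\Sigma\setminus\mathcal{D}$. A term is basic if it has the form $f(t_1,\dots,t_n)$ with $f\in\mathcal{D}$ and all $t_i\in\mathcal{T}(\mathcal{C},\mathcal{V})$. $\mathrm{Pos}(t)$, $t|_\pi$, $t[r]_\pi$ denote positions, subterm, replacement. A substitution is $\sigma:\mathcal{V}\to\mathcal{T}$ with $\sigma(x)=x$ for all but finitely many $x$. For each $f\in\mathcal{D}$ let $f^\#$ be a fresh symbol of the same arity; $\mathcal{D}^\#=\{f^\#\mid f\in\mathcal{D}\}$, $\Sigma^\#=\Sigma\uplus\mathcal{D}^\#$, $\mathcal{T}^\#=\mathcal{T}(\Sigma^\#,\mathcal{V})$. For $t=f(t_1,\dots,t_n)\in\mathcal{T}$ with $f\in\mathcal{D}$, $t^\#=f^\#(t_1,\dots,t_n)$. $\mathrm{Pos}_X(t)$ is the set of positions of $t$ carrying a symbol or variable from $X$. For $\Phi\subseteq\mathrm{Pos}_{\mathcal{D}\cup\mathcal{D}^\#}(t)$, $\#_\Phi(t)$ is the variant of $t$ where exactly the symbols at positions in $\Phi$ are annotated (all other annotations removed); $\flat(t)=\#_\emptyset(t)$. $\flat^\uparrow_\pi(t)$ results from $t$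 by removing all annotations strictly above $\pi$. We write $t\trianglelefteq_\# s$ if there is $\pi\in\mathrm{Pos}_{\mathcal{D}^\#}(s)$ with $t=\flat(s|_\pi)$. **ADPs.** An annotated dependency pair (ADP) has the form $\ell\to\{p_1:r_1,\dots,p_k:r_k\}^m$ with $\ell\in\mathcal{T}\setminus\mathcal{V}$, $m\in\{\mathsf{true},\mathsf{false}\}$, $r_j\in\mathcal{T}^\#$, all variables of $r_j$ occurring in $\ell$, probabilities $p_j\in(0,1]$ summing to $1$. An ADP problem is a finite set of ADPs. **Rewriting with ADPs.** A variable reposition function (VRF) for an ADP $\ell\to\{p_1:r_1,\dots,p_k:r_k\}^m$ is a family of functions $\varphi_j:\mathrm{Pos}_{\mathcal{V}}(\ell)\to\mathrm{Pos}_{\mathcal{V}}(r_j)\uplus\{\bot\}$, $1\le j\le k$, with $\ell|_\rho=r_j|_{\varphi_j(\rho)}$ whenever $\varphi_j(\rho)\ne\bot$. A term $s\in\mathcal{T}^\#$ rewrites with $\mathcal{P}$ to $\{p_1:t_1,\dots,p_k:t_k\}$ (written $s\hookrightarrow_{\mathcal{P}}\{p_1:t_1,\dots,p_k:t_k\}$) if there are an ADP $\ell\to\{p_1:r_1,\dots,p_k:r_k\}^m\in\mathcal{P}$, a VRF $(\varphi_j)_j$ for it, a substitution $\sigma$ and $\pi\in\mathrm{Pos}_{\mathcal{D}\cup\mathcal{D}^\#}(s)$ with $\flat(s|_\pi)=\ell\sigma$, such that for all $j$: - (at) $t_j=s[\#_{\Phi_j}(r_j\sigma)]_\pi$ if $\pi\in\mathrm{Pos}_{\mathcal{D}^\#}(s)$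 and $m=\mathsf{true}$; - (af) $t_j=\flat^\uparrow_\pi(s[\#_{\Phi_j}(r_j\sigma)]_\pi)$ if $\pi\in\mathrm{Pos}_{\mathcal{D}^\#}(s)$ and $m=\mathsf{false}$; - (nt) $t_j=s[\#_{\Psi_j}(r_j\sigma)]_\pi$ if $\pi\notin\mathrm{Pos}_{\mathcal{D}^\#}(s)$ and $m=\mathsf{true}$. (There is no step if $\pi\notin\mathrm{Pos}_{\mathcal{D}^\#}(s)$ and $m=\mathsf{false}$.) Here $\Psi_j=\{\varphi_j(\rho).\tau\mid\rho\in\mathrm{Pos}_{\mathcal{V}}(\ell),\ \varphi_j(\rho)\ne\bot,\ \rho.\tau\in\mathrm{Pos}_{\mathcal{D}^\#}(s|_\pi)\}$ and $\Phi_j=\mathrm{Pos}_{\mathcal{D}^\#}(r_j)\cup\Psi_j$. **Chain trees, AST, bAST.** A $\mathcal{P}$-chain tree (CT) is $\mathfrak{T}=(V,E,L,A)$ where $(V,E)$ is a non-empty, possibly infinite, finitely branching directed tree; $L$ labels each node $v$ by a probability $p_v\in(0,1]$ and a term $t_v\in\mathcal{T}^\#$, with $p_v=1$ for the root; $A$ is a subset of the inner nodes; for each inner node $v$ with successors $w_1,\dots,w_k$, $t_v\hookrightarrow_{\mathcal{P}}\{\frac{p_{w_1}}{p_v}:t_{w_1},\dots,\frac{p_{w_k}}{p_v}:t_{w_k}\}$ using case (at) or (af) if $v\in A$ and another case if $v\notin A$; and every infinite path contains infinitely many nodes from $A$. $|\mathfrak{T}|_{\mathrm{Leaf}}$ is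 the sum of $p_v$ over all leaves $v$. $\mathcal{P}$ is $\mathtt{AST}$ if $|\mathfrak{T}|_{\mathrm{Leaf}}=1$ for all $\mathcal{P}$-CTs $\mathfrak{T}$. A basic ADP problem is a pair $(\mathcal{I},\mathcal{P})$ of finite sets of ADPs; it is $\mathtt{bAST}$ if $|\mathfrak{T}|_{\mathrm{Leaf}}=1$ for all those $(\mathcal{I}\cup\mathcal{P})$-CTs $\mathfrak{T}$ whose root term is $t^\#$ for a basic term $t\in\mathcal{T}$ and in which ADPs from $\mathcal{I}\setminus\mathcal{P}$ are used only finitely often within the whole tree. **Non-probabilistic DP problems.** A DP problem $(\mathcal{E},\mathcal{R})$ consists of a set $\mathcal{E}$ of dependency pairs (rules with annotations exactly at the roots of both sides) and an ordinary term rewrite system $\mathcal{R}$ over $\Sigma$. It is non-terminating if there is an infinite chain $t_0,t_1,t_2,\dots$ of terms, each of the form $u^\#$ with $u\in\mathcal{T}$ (annotated exactly at the root), with $t_i\to_{\mathcal{E}}\circ\to^*_{\mathcal{R}}t_{i+1}$ for all $i\in\mathbb{N}$, where $\circ$ is composition; otherwise it is terminating. **Processors.** A processor maps a (basic) ADP problem to a finite set of (basic) ADP problems. On a given input it is sound for $\mathtt{AST}$ (resp. $\mathtt{bAST}$) if the input has this property whenever all resulting problems have it, and complete if all resulting problems have it whenever the input has it. (If the result is $\emptyset$, soundness thus means that the input has the property.) *)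

theory Defs
  imports "HOL-Analysis.Infinite_Sum" "HOL-Library.Multiset" "HOL-Library.Sublist"
begin

subsection \<open>Terms, positions, annotations\<close>

datatype (dead 'f, vars: 'v) trm = Var 'v | Fun 'f "('f, 'v) trm list"

text \<open>Symbols of $\Sigma^\#$: \<open>Ann f\<close> is the fresh annotated copy $f^\#$ of \<open>Sym f\<close>.
  All terms live in one type, so that $\mathcal{T} \subseteq \mathcal{T}^\#$ is set inclusion.\<close>

datatype 'f ann = Sym (base: 'f) | Ann (base: 'f)

type_synonym ('f, 'v) aterm = "('f ann, 'v) trm"

type_synonym pos = "nat list"

record ('f, 'v) signature =
  symbols :: "'f set"
  arity :: "'f \<Rightarrow> nat"
  variables :: "'v set"

inductive_set terms :: "'g set \<Rightarrow> ('g \<Rightarrow> nat) \<Rightarrow> 'v set \<Rightarrow> ('g, 'v) trm set"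
  for F :: "'g set" and ar :: "'g \<Rightarrow> nat" and V :: "'v set" where
  "x \<in> V \<Longrightarrow> Var x \<in> terms F ar V"
| "f \<in> F \<Longrightarrow> length ts = ar f \<Longrightarrow> (\<forall>t \<in> set ts. t \<in> terms F ar V) \<Longrightarrow> Fun f ts \<in> terms F ar V"

definition plain_terms :: "('f, 'v) signature \<Rightarrow> ('f, 'v) aterm set" where
  "plain_terms S = terms (Sym ` symbols S) (arity S \<circ> base) (variables S)"

definition ann_terms :: "('f, 'v) signature \<Rightarrow> 'f set \<Rightarrow> ('f, 'v) aterm set" where
  "ann_terms S D = terms (Sym ` symbols S \<union> Ann ` D) (arity S \<circ> base) (variables S)"

definition basic_terms :: "('f, 'v) signature \<Rightarrow> 'f set \<Rightarrow> ('f, 'v) aterm set" where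
  "basic_terms S D = {t \<in> plain_terms S. \<exists>f ts. t = Fun (Sym f) ts \<and> f \<in> D \<and>
     (\<forall>u \<in> set ts. u \<in> terms (Sym ` (symbols S - D)) (arity S \<circ> base) (variables S))}"

lemma size_nth_less [termination_simp]:
  "i < length ts \<Longrightarrow> size (ts ! i) < Suc (size_list size ts)"
  by (simp add: less_Suc_eq_le size_list_estimation' [OF nth_mem])

declare conj_cong [fundef_cong]

fun poss :: "('g, 'v) trm \<Rightarrow> pos set" where
  "poss (Var x) = {[]}"
| "poss (Fun f ts) = {[]} \<union> {i # p | i p. i < length ts \<and> p \<in> poss (ts ! i)}"

fun subterm_at :: "('g, 'v) trm \<Rightarrow> pos \<Rightarrow> ('g, 'v) trm" where
  "subterm_at t [] = t"
| "subterm_at (Fun f ts) (i # p) = subterm_at (ts ! i) p"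

fun replace_at :: "('g, 'v) trm \<Rightarrow> pos \<Rightarrow> ('g, 'v) trm \<Rightarrow> ('g, 'v) trm" where
  "replace_at t [] u = u"
| "replace_at (Fun f ts) (i # p) u = Fun f (ts[i := replace_at (ts ! i) p u])"

definition sym_poss :: "'g set \<Rightarrow> ('g, 'v) trm \<Rightarrow> pos set" where
  "sym_poss X t = {p \<in> poss t. \<exists>f ts. subterm_at t p = Fun f ts \<and> f \<in> X}"

definition var_poss :: "('g, 'v) trm \<Rightarrow> pos set" where
  "var_poss t = {p \<in> poss t. \<exists>x. subterm_at t p = Var x}"

primrec subst :: "('v \<Rightarrow> ('g, 'v) trm) \<Rightarrow> ('g, 'v) trm \<Rightarrow> ('g, 'v) trm" where
  "subst \<sigma> (Var x) = \<sigma> x"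
| "subst \<sigma> (Fun f ts) = Fun f (map (subst \<sigma>) ts)"

text \<open>The values of \<open>\<sigma>\<close> outside the set of variables of the signature are irrelevant.\<close>

definition substitution :: "('f, 'v) signature \<Rightarrow> ('v \<Rightarrow> ('f, 'v) aterm) \<Rightarrow> bool" where
  "substitution S \<sigma> \<longleftrightarrow>
     (\<forall>x \<in> variables S. \<sigma> x \<in> plain_terms S) \<and> finite {x \<in> variables S. \<sigma> x \<noteq> Var x}"

text \<open>\<open>annotate \<Phi> t\<close> is $\#_\Phi(t)$: exactly the symbols at positions in \<open>\<Phi>\<close> are annotated.\<close>

fun annotate :: "pos set \<Rightarrow> ('f, 'v) aterm \<Rightarrow> ('f, 'v) aterm" where
  "annotate \<Phi> (Var x) = Var x"
| "annotate \<Phi> (Fun f ts) =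
     Fun (if [] \<in> \<Phi> then Ann (base f) else Sym (base f))
       (map (\<lambda>i. annotate {p. i # p \<in> \<Phi>} (ts ! i)) [0..<length ts])"

definition flat :: "('f, 'v) aterm \<Rightarrow> ('f, 'v) aterm" where
  "flat t = annotate {} t"

definition flat_above :: "'f set \<Rightarrow> pos \<Rightarrow> ('f, 'v) aterm \<Rightarrow> ('f, 'v) aterm" where
  "flat_above D \<pi> t = annotate {\<rho> \<in> sym_poss (Ann ` D) t. \<not> strict_prefix \<rho> \<pi>} t"

fun sharp :: "('f, 'v) aterm \<Rightarrow> ('f, 'v) aterm" where
  "sharp (Var x) = Var x"
| "sharp (Fun f ts) = Fun (Ann (base f)) ts"

definition ann_subterm :: "'f set \<Rightarrow> ('f, 'v) aterm \<Rightarrow> ('f, 'v) aterm \<Rightarrow> bool" where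
  "ann_subterm D t s \<longleftrightarrow> (\<exists>\<pi> \<in> sym_poss (Ann ` D) s. t = flat (subterm_at s \<pi>))"


subsection \<open>Annotated dependency pairs\<close>

text \<open>$\ell \to \{p_1:r_1,\dots,p_k:r_k\}^m$ is the triple of \<open>\<ell>\<close>, the multiset of
  the pairs \<open>(p\<^sub>j, r\<^sub>j)\<close>, and the flag \<open>m\<close>.\<close>

type_synonym ('f, 'v) adp = "('f, 'v) aterm \<times> (real \<times> ('f, 'v) aterm) multiset \<times> bool"

definition is_adp :: "('f, 'v) signature \<Rightarrow> 'f set \<Rightarrow> ('f, 'v) adp \<Rightarrow> bool" where
  "is_adp S D = (\<lambda>(l, \<mu>, m).
     l \<in> plain_terms S \<and> (\<nexists>x. l = Var x) \<and>
     (\<forall>(p, r) \<in># \<mu>. 0 < p \<and> p \<le> 1 \<and> r \<in> ann_terms S D \<and> vars r \<subseteq> vars l) \<and>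
     (\<Sum>(p, r) \<in># \<mu>. p) = 1)"

definition defined :: "('f, 'v) adp set \<Rightarrow> 'f set" where
  "defined P = {f. \<exists>ts \<mu> m. (Fun (Sym f) ts, \<mu>, m) \<in> P}"

definition adp_problem :: "('f, 'v) signature \<Rightarrow> ('f, 'v) adp set \<Rightarrow> bool" where
  "adp_problem S P \<longleftrightarrow> finite P \<and> (\<forall>\<alpha> \<in> P. is_adp S (defined P) \<alpha>)"

definition basic_adp_problem ::
  "('f, 'v) signature \<Rightarrow> ('f, 'v) adp set \<times> ('f, 'v) adp set \<Rightarrow> bool" where
  "basic_adp_problem S = (\<lambda>(I, P).
     finite I \<and> finite P \<and> (\<forall>\<alpha> \<in> I \<union> P. is_adp S (defined (I \<union> P)) \<alpha>))"


subsection \<open>Rewriting with ADPs\<close>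

text \<open>The right-hand sides are enumerated by a list \<open>rs\<close> (indices start at 0);
  \<open>None\<close> plays the role of $\bot$.\<close>

definition vrf ::
  "('f, 'v) aterm \<Rightarrow> (real \<times> ('f, 'v) aterm) list \<Rightarrow> (nat \<Rightarrow> pos \<Rightarrow> pos option) \<Rightarrow> bool" where
  "vrf l rs \<phi> \<longleftrightarrow> (\<forall>j < length rs. \<forall>\<rho> \<in> var_poss l. \<forall>\<tau>. \<phi> j \<rho> = Some \<tau> \<longrightarrow>
     \<tau> \<in> var_poss (snd (rs ! j)) \<and> subterm_at l \<rho> = subterm_at (snd (rs ! j)) \<tau>)"

definition Psi :: "'f set \<Rightarrow> ('f, 'v) aterm \<Rightarrow> (pos \<Rightarrow> pos option) \<Rightarrow> ('f, 'v) aterm \<Rightarrow> pos set" where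
  "Psi D l \<phi>j u = {\<rho>' @ \<tau> | \<rho> \<rho>' \<tau>.
     \<rho> \<in> var_poss l \<and> \<phi>j \<rho> = Some \<rho>' \<and> \<rho> @ \<tau> \<in> sym_poss (Ann ` D) u}"

definition Phi :: "'f set \<Rightarrow> ('f, 'v) aterm \<Rightarrow> (pos \<Rightarrow> pos option) \<Rightarrow> ('f, 'v) aterm \<Rightarrow>
    ('f, 'v) aterm \<Rightarrow> pos set" where
  "Phi D l \<phi>j u r = sym_poss (Ann ` D) r \<union> Psi D l \<phi>j u"

definition redex :: "('f, 'v) signature \<Rightarrow> 'f set \<Rightarrow> ('f, 'v) aterm \<Rightarrow>
    ('v \<Rightarrow> ('f, 'v) aterm) \<Rightarrow> ('f, 'v) aterm \<Rightarrow> pos \<Rightarrow> bool" where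
  "redex S D l \<sigma> s \<pi> \<longleftrightarrow> s \<in> ann_terms S D \<and> substitution S \<sigma> \<and>
     \<pi> \<in> sym_poss (Sym ` D \<union> Ann ` D) s \<and> flat (subterm_at s \<pi>) = subst \<sigma> l"

datatype step_case = AT | AF | NT

text \<open>\<open>adp_step S D \<alpha> c s M\<close>: the term \<open>s\<close> rewrites to the multi-distribution \<open>M\<close>
  with the ADP \<open>\<alpha>\<close>, using case \<open>c\<close>.\<close>

inductive adp_step :: "('f, 'v) signature \<Rightarrow> 'f set \<Rightarrow> ('f, 'v) adp \<Rightarrow> step_case \<Rightarrow>
    ('f, 'v) aterm \<Rightarrow> (real \<times> ('f, 'v) aterm) multiset \<Rightarrow> bool"
  for S :: "('f, 'v) signature" and D :: "'f set" where
  at: "vrf l rs \<phi> \<Longrightarrow> redex S D l \<sigma> s \<pi> \<Longrightarrow> \<pi> \<in> sym_poss (Ann ` D) s \<Longrightarrow>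
    adp_step S D (l, mset rs, True) AT s
      (mset (map (\<lambda>j. (fst (rs ! j),
          replace_at s \<pi> (annotate (Phi D l (\<phi> j) (subterm_at s \<pi>) (snd (rs ! j)))
            (subst \<sigma> (snd (rs ! j))))))
        [0..<length rs]))"
| af: "vrf l rs \<phi> \<Longrightarrow> redex S D l \<sigma> s \<pi> \<Longrightarrow> \<pi> \<in> sym_poss (Ann ` D) s \<Longrightarrow>
    adp_step S D (l, mset rs, False) AF s
      (mset (map (\<lambda>j. (fst (rs ! j),
          flat_above D \<pi>
            (replace_at s \<pi> (annotate (Phi D l (\<phi> j) (subterm_at s \<pi>) (snd (rs ! j)))
              (subst \<sigma> (snd (rs ! j)))))))
        [0..<length rs]))"
| nt: "vrf l rs \<phi> \<Longrightarrow> redex S D l \<sigma> s \<pi> \<Longrightarrow> \<pi> \<notin> sym_poss (Ann ` D) s \<Longrightarrow>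
    adp_step S D (l, mset rs, True) NT s
      (mset (map (\<lambda>j. (fst (rs ! j),
          replace_at s \<pi> (annotate (Psi D l (\<phi> j) (subterm_at s \<pi>))
            (subst \<sigma> (snd (rs ! j))))))
        [0..<length rs]))"


subsection \<open>Chain trees and almost-sure termination\<close>

text \<open>A finitely branching directed tree is countable, so natural numbers suffice as nodes.\<close>

record ('f, 'v) tree =
  nodes :: "nat set"
  edges :: "(nat \<times> nat) set"
  root :: nat
  prob :: "nat \<Rightarrow> real"
  label :: "nat \<Rightarrow> ('f, 'v) aterm"
  A_nodes :: "nat set"

definition directed_tree :: "nat set \<Rightarrow> (nat \<times> nat) set \<Rightarrow> nat \<Rightarrow> bool" where
  "directed_tree V E r \<longleftrightarrow> r \<in> V \<and> E \<subseteq> V \<times> V \<and> (\<forall>u. (u, r) \<notin> E) \<and>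
     (\<forall>v \<in> V - {r}. \<exists>!u. (u, v) \<in> E) \<and> (\<forall>v \<in> V. (r, v) \<in> E\<^sup>*)"

definition inner :: "('f, 'v) tree \<Rightarrow> nat set" where
  "inner T = {v \<in> nodes T. edges T `` {v} \<noteq> {}}"

definition leaves :: "('f, 'v) tree \<Rightarrow> nat set" where
  "leaves T = {v \<in> nodes T. edges T `` {v} = {}}"

text \<open>The term labels do not determine which ADP was used, so \<open>chain_tree S P T rule\<close> has the
  additional argument \<open>rule\<close>, which assigns to each inner node of \<open>T\<close> the ADP used there.\<close>

definition chain_tree ::
  "('f, 'v) signature \<Rightarrow> ('f, 'v) adp set \<Rightarrow> ('f, 'v) tree \<Rightarrow> (nat \<Rightarrow> ('f, 'v) adp) \<Rightarrow> bool" where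
  "chain_tree S P T rule \<longleftrightarrow>
     directed_tree (nodes T) (edges T) (root T) \<and>
     (\<forall>v \<in> nodes T. finite (edges T `` {v})) \<and>
     (\<forall>v \<in> nodes T. 0 < prob T v \<and> prob T v \<le> 1 \<and> label T v \<in> ann_terms S (defined P)) \<and>
     prob T (root T) = 1 \<and>
     A_nodes T \<subseteq> inner T \<and>
     (\<forall>v \<in> inner T. rule v \<in> P \<and>
        (\<exists>c. (c \<in> {AT, AF} \<longleftrightarrow> v \<in> A_nodes T) \<and>
           adp_step S (defined P) (rule v) c (label T v)
             (image_mset (\<lambda>w. (prob T w / prob T v, label T w)) (mset_set (edges T `` {v}))))) \<and>
     (\<forall>path :: nat \<Rightarrow> nat. (\<forall>i. (path i, path (Suc i)) \<in> edges T) \<longrightarrow>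
        infinite (range path \<inter> A_nodes T))"

definition leaf_prob :: "('f, 'v) tree \<Rightarrow> real" where
  "leaf_prob T = (\<Sum>\<^sub>\<infinity>v \<in> leaves T. prob T v)"

definition AST :: "('f, 'v) signature \<Rightarrow> ('f, 'v) adp set \<Rightarrow> bool" where
  "AST S P \<longleftrightarrow> (\<forall>T rule. chain_tree S P T rule \<longrightarrow> leaf_prob T = 1)"

definition bAST :: "('f, 'v) signature \<Rightarrow> ('f, 'v) adp set \<times> ('f, 'v) adp set \<Rightarrow> bool" where
  "bAST S = (\<lambda>(I, P). \<forall>T rule.
     chain_tree S (I \<union> P) T rule \<and>
     (\<exists>t \<in> basic_terms S (defined (I \<union> P)). label T (root T) = sharp t) \<and>
     finite {v \<in> inner T. rule v \<in> I - P} \<longrightarrow> leaf_prob T = 1)"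


subsection \<open>Non-probabilistic dependency pair problems\<close>

type_synonym ('f, 'v) trs = "(('f, 'v) aterm \<times> ('f, 'v) aterm) set"

definition rewrite :: "('f, 'v) signature \<Rightarrow> ('f, 'v) trs \<Rightarrow> (('f, 'v) aterm \<times> ('f, 'v) aterm) set" where
  "rewrite S R = {(s, t). \<exists>l r \<sigma> \<pi>. (l, r) \<in> R \<and> substitution S \<sigma> \<and> \<pi> \<in> poss s \<and>
     subterm_at s \<pi> = subst \<sigma> l \<and> t = replace_at s \<pi> (subst \<sigma> r)}"

definition sharp_terms :: "('f, 'v) signature \<Rightarrow> 'f set \<Rightarrow> ('f, 'v) aterm set" where
  "sharp_terms S D = {sharp u | u. u \<in> plain_terms S \<and> (\<exists>f ts. u = Fun (Sym f) ts \<and> f \<in> D)}"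

definition dp_terminating ::
  "('f, 'v) signature \<Rightarrow> 'f set \<Rightarrow> ('f, 'v) trs \<times> ('f, 'v) trs \<Rightarrow> bool" where
  "dp_terminating S D = (\<lambda>(E, R).
     \<not> (\<exists>t :: nat \<Rightarrow> ('f, 'v) aterm. \<forall>i. t i \<in> sharp_terms S D \<and>
          (t i, t (Suc i)) \<in> rewrite S E O (rewrite S R)\<^sup>*))"

definition dp :: "'f set \<Rightarrow> ('f, 'v) adp set \<Rightarrow> ('f, 'v) trs" where
  "dp D P = {(sharp l, sharp t) | l r m t. (l, {#(1, r)#}, m) \<in> P \<and> ann_subterm D t r}"

definition np :: "('f, 'v) adp set \<Rightarrow> ('f, 'v) trs" where
  "np P = {(l, flat r) | l r. (l, {#(1, r)#}, True) \<in> P}"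


subsection \<open>Processors\<close>

text \<open>The problem type \<open>'p\<close> is instantiated both by ADP problems and by basic ADP problems.\<close>

definition sound_on :: "('p \<Rightarrow> bool) \<Rightarrow> ('p \<Rightarrow> 'p set) \<Rightarrow> 'p \<Rightarrow> bool" where
  "sound_on Q proc X \<longleftrightarrow> ((\<forall>Y \<in> proc X. Q Y) \<longrightarrow> Q X)"

definition complete_on :: "('p \<Rightarrow> bool) \<Rightarrow> ('p \<Rightarrow> 'p set) \<Rightarrow> 'p \<Rightarrow> bool" where
  "complete_on Q proc X \<longleftrightarrow> (Q X \<longrightarrow> (\<forall>Y \<in> proc X. Q Y))"

definition proc_PR :: "'p \<Rightarrow> 'p set" where
  "proc_PR X = {}"

end

theory Submission
  imports Defs
begin

text \<open>
  A chain tree in which only finitely many nodes branch has leaf probability 1 unless it has an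
  infinite path, and such a path eventually uses only non-probabilistic ADPs. Along it, every
  annotated position of a term has an origin in the previous term. The corresponding subterms,
  with all other annotations dropped, are equal or related by a step of \<open>np P\<close>, except that the
  positions created by rewriting an annotated redex are obtained from it by a step of \<open>dp\<close>.
  Since the origins form a finitely branching forest that branches only at annotated redexes,
  some branch passes through infinitely many of them, and this branch is an infinite chain.

  Conversely, a chain is simulated below an annotated position that moves down with each step of
  \<open>dp\<close>, using the empty variable reposition function; the result is a chain tree that is a single
  infinite path and has no leaf.
\<close>

subsection \<open>Positions\<close>

lemma Nil_in_poss [simp]: "[] \<in> poss t"
  by (cases t) auto

lemma poss_append [simp]:
  "p @ q \<in> poss t \<longleftrightarrow> p \<in> poss t \<and> q \<in> poss (subterm_at t p)"
proof (induction p arbitrary: t)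
  case (Cons i p)
  then show ?case by (cases t) auto
qed (cases t; auto)

lemma subterm_at_append [simp]:
  "p \<in> poss t \<Longrightarrow> subterm_at t (p @ q) = subterm_at (subterm_at t p) q"
proof (induction p arbitrary: t)
  case (Cons i p)
  then show ?case by (cases t) auto
qed auto

lemma poss_replace_at_below [simp]:
  "p \<in> poss t \<Longrightarrow> p \<in> poss (replace_at t p u)"
proof (induction p arbitrary: t)
  case (Cons i p)
  then show ?case by (cases t) auto
qed auto

lemma subterm_at_replace_at_same [simp]:
  "p \<in> poss t \<Longrightarrow> subterm_at (replace_at t p u) p = u"
proof (induction p arbitrary: t)
  case (Cons i p)
  then show ?case by (cases t) auto
qed auto

lemma subterm_at_replace_at_above:
  "p @ q \<in> poss t \<Longrightarrow> subterm_at (replace_at t (p @ q) u) p = replace_at (subterm_at t p) q u"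
proof (induction p arbitrary: t)
  case (Cons i p)
  then show ?case by (cases t) auto
qed auto

lemma poss_replace_at:
  assumes "p \<in> poss t" "\<not> prefix p q"
  shows "q \<in> poss (replace_at t p u) \<longleftrightarrow> q \<in> poss t"
  using assms
proof (induction p arbitrary: t q)
  case (Cons i p)
  then obtain f ts where t: "t = Fun f ts" "i < length ts" "p \<in> poss (ts ! i)"
    by (cases t) auto
  show ?case
  proof (cases q)
    case (Cons j q')
    with Cons.IH[OF t(3)] Cons.prems show ?thesis
      by (cases "i = j") (auto simp: t)
  qed auto
qed auto

lemma subterm_at_replace_at_parallel:
  assumes "p \<in> poss t" "q \<in> poss t" "\<not> prefix p q" "\<not> prefix q p"
  shows "subterm_at (replace_at t p u) q = subterm_at t q"
  using assms
proof (induction p arbitrary: t q)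
  case (Cons i p)
  then obtain f ts where t: "t = Fun f ts" "i < length ts" "p \<in> poss (ts ! i)"
    by (cases t) auto
  show ?case
  proof (cases q)
    case Nil
    with Cons.prems show ?thesis by simp
  next
    case (Cons j q')
    with Cons.IH[OF t(3)] Cons.prems show ?thesis
      by (cases "i = j") (auto simp: t)
  qed
qed auto

lemma sharp_replace_at:
  "q \<noteq> [] \<Longrightarrow> q \<in> poss t \<Longrightarrow> sharp (replace_at t q u) = replace_at (sharp t) q u"
  by (cases t; cases q) auto

lemma subterm_at_sharp:
  "q \<noteq> [] \<Longrightarrow> q \<in> poss t \<Longrightarrow> subterm_at (sharp t) q = subterm_at t q"
  by (cases t; cases q) auto

lemma poss_sharp [simp]: "poss (sharp t) = poss t"
  by (cases t) auto

lemma finite_poss [simp]: "finite (poss t)"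
proof (induction t)
  case (Fun f ts)
  have "{i # p | i p. i < length ts \<and> p \<in> poss (ts ! i)}
      = (\<Union>i < length ts. (#) i ` poss (ts ! i))" by auto
  with Fun show ?case by simp
qed auto

lemma finite_sym_poss [simp]: "finite (sym_poss X t)"
  unfolding sym_poss_def by (rule finite_subset[OF _ finite_poss]) auto

lemma poss_subst: "p \<in> poss t \<Longrightarrow> p \<in> poss (subst \<sigma> t)"
proof (induction p arbitrary: t)
  case (Cons i p)
  then show ?case by (cases t) auto
qed auto

lemma subterm_at_subst:
  "p \<in> poss t \<Longrightarrow> subterm_at (subst \<sigma> t) p = subst \<sigma> (subterm_at t p)"
proof (induction p arbitrary: t)
  case (Cons i p)
  then show ?case by (cases t) auto
qed auto

lemma vars_subterm_at: "p \<in> poss t \<Longrightarrow> vars (subterm_at t p) \<subseteq> vars t"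
proof (induction p arbitrary: t)
  case (Cons i p)
  then obtain f ts where "t = Fun f ts" "i < length ts" "p \<in> poss (ts ! i)"
    by (cases t) auto
  with Cons.IH[of "ts ! i"] show ?case
    by (auto dest: nth_mem)
qed auto

text \<open>A variable has no proper subterm, so no variable position properly extends another.
  Hence a position splits in only one way into a variable position of the left-hand side and a rest,
  which makes origins injective.\<close>

lemma var_poss_prefix_free:
  assumes "p \<in> var_poss t" "q \<in> var_poss t" "p @ p' = q @ q'"
  shows "p = q"
proof -
  have *: "p = q" if "p \<in> var_poss t" "q \<in> var_poss t" "q = p @ r" for p q r
    using that by (cases r) (auto simp: var_poss_def)
  from assms(3) obtain r where "q = p @ r \<or> p = q @ r"
    unfolding append_eq_append_conv2 by blast
  then show ?thesis using *[OF assms(1,2)] *[OF assms(2,1)] by blast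
qed

subsection \<open>Annotations\<close>

lemma flat_Var [simp]: "flat (Var x) = Var x"
  by (simp add: flat_def)

lemma flat_Fun [simp]: "flat (Fun f ts) = Fun (Sym (base f)) (map flat ts)"
  by (auto simp: flat_def intro: nth_equalityI)

lemma poss_annotate [simp]: "poss (annotate \<Phi> t) = poss t"
proof -
  have "p \<in> poss (annotate \<Phi> t) \<longleftrightarrow> p \<in> poss t" for p
  proof (induction p arbitrary: t \<Phi>)
    case (Cons i p)
    then show ?case by (cases t) auto
  qed auto
  then show ?thesis by auto
qed

lemma poss_flat [simp]: "poss (flat t) = poss t"
  by (simp add: flat_def)

lemma subterm_at_annotate:
  "p \<in> poss t \<Longrightarrow> subterm_at (annotate \<Phi> t) p = annotate {q. p @ q \<in> \<Phi>} (subterm_at t p)"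
proof (induction p arbitrary: t \<Phi>)
  case (Cons i p)
  then show ?case by (cases t) auto
qed auto

lemma subterm_at_flat: "p \<in> poss t \<Longrightarrow> subterm_at (flat t) p = flat (subterm_at t p)"
  by (simp add: flat_def subterm_at_annotate)

lemma flat_annotate [simp]: "flat (annotate \<Phi> t) = flat t"
proof (induction t arbitrary: \<Phi>)
  case (Fun f ts)
  then show ?case by (auto intro!: nth_equalityI)
qed auto

lemma flat_flat [simp]: "flat (flat t) = flat t"
  by (metis flat_annotate flat_def)

lemma flat_replace_at:
  "p \<in> poss t \<Longrightarrow> flat (replace_at t p u) = replace_at (flat t) p (flat u)"
proof (induction p arbitrary: t)
  case (Cons i p)
  then show ?case by (cases t) (auto simp: map_update)
qed auto

lemma sym_poss_annotate:
  "sym_poss (Ann ` D) (annotate \<Phi> t) =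
     {p \<in> \<Phi> \<inter> poss t. \<exists>f ts. subterm_at t p = Fun f ts \<and> base f \<in> D}"
proof -
  have "(\<exists>g us. annotate \<Psi> u = Fun g us \<and> g \<in> Ann ` D) \<longleftrightarrow>
        [] \<in> \<Psi> \<and> (\<exists>f ts. u = Fun f ts \<and> base f \<in> D)" for \<Psi> and u :: "('a, 'b) aterm"
    by (cases u) auto
  then have "(\<exists>g us. subterm_at (annotate \<Phi> t) p = Fun g us \<and> g \<in> Ann ` D) \<longleftrightarrow>
        p \<in> \<Phi> \<and> (\<exists>f ts. subterm_at t p = Fun f ts \<and> base f \<in> D)" if "p \<in> poss t" for p
    using that by (simp only: subterm_at_annotate) simp
  then show ?thesis
    unfolding sym_poss_def poss_annotate by blast
qed

lemma sym_poss_flat_above: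
  "sym_poss (Ann ` D) (flat_above D \<pi> t) = {\<rho> \<in> sym_poss (Ann ` D) t. \<not> strict_prefix \<rho> \<pi>}"
  unfolding flat_above_def sym_poss_annotate by (auto simp: sym_poss_def)

lemma sym_poss_appendI:
  "p \<in> poss t \<Longrightarrow> p @ q \<in> sym_poss X t \<longleftrightarrow> q \<in> sym_poss X (subterm_at t p)"
  by (auto simp: sym_poss_def)

subsection \<open>Well-formed terms\<close>

lemma terms_VarD: "Var x \<in> terms F ar V \<Longrightarrow> x \<in> V"
  by (auto elim: terms.cases)

lemma terms_FunD:
  "Fun f ts \<in> terms F ar V \<Longrightarrow> f \<in> F \<and> length ts = ar f \<and> (\<forall>t \<in> set ts. t \<in> terms F ar V)"
  by (auto elim: terms.cases)

lemma terms_Var_iff [simp]: "Var x \<in> terms F ar V \<longleftrightarrow> x \<in> V"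
  by (auto dest: terms_VarD intro: terms.intros)

lemma terms_Fun_iff [simp]:
  "Fun f ts \<in> terms F ar V \<longleftrightarrow> f \<in> F \<and> length ts = ar f \<and> (\<forall>t \<in> set ts. t \<in> terms F ar V)"
  by (auto dest: terms_FunD intro: terms.intros)

lemma terms_mono: "F \<subseteq> G \<Longrightarrow> t \<in> terms F ar V \<Longrightarrow> t \<in> terms G ar V"
  by (induction t) auto

lemma plain_terms_subset: "plain_terms S \<subseteq> ann_terms S D"
  unfolding plain_terms_def ann_terms_def by (auto intro: terms_mono[rotated])

lemma vars_terms: "t \<in> terms F ar V \<Longrightarrow> vars t \<subseteq> V"
  by (induction t) auto

lemma subterm_at_terms: "t \<in> terms F ar V \<Longrightarrow> p \<in> poss t \<Longrightarrow> subterm_at t p \<in> terms F ar V"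
proof (induction p arbitrary: t)
  case (Cons i p)
  then show ?case by (cases t) auto
qed auto

lemma replace_at_terms:
  "t \<in> terms F ar V \<Longrightarrow> u \<in> terms F ar V \<Longrightarrow> p \<in> poss t \<Longrightarrow> replace_at t p u \<in> terms F ar V"
proof (induction p arbitrary: t)
  case (Cons i p)
  then show ?case
    by (cases t) (auto dest!: set_update_subset_insert[THEN subsetD])
qed auto

lemma subst_terms:
  "t \<in> terms F ar V \<Longrightarrow> (\<And>x. x \<in> V \<Longrightarrow> \<sigma> x \<in> terms F ar V) \<Longrightarrow> subst \<sigma> t \<in> terms F ar V"
  by (induction t) auto

lemma subst_ann_terms:
  "t \<in> ann_terms S D \<Longrightarrow> substitution S \<sigma> \<Longrightarrow> subst \<sigma> t \<in> ann_terms S D"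
  using plain_terms_subset[of S D]
  by (auto simp: ann_terms_def substitution_def intro!: subst_terms)

text \<open>\<open>Ann f\<close> is a symbol only for \<open>f\<close> in \<open>D\<close>, so
  \<open>\<Phi>\<close> must not select symbols with a base outside \<open>D\<close>. Conversely,
  \<open>D \<subseteq> symbols S\<close> covers the annotations that get removed.\<close>

lemma annotate_ann_terms:
  assumes "t \<in> ann_terms S D" "D \<subseteq> symbols S"
    and "\<And>p f ts. p \<in> \<Phi> \<Longrightarrow> p \<in> poss t \<Longrightarrow> subterm_at t p = Fun f ts \<Longrightarrow> base f \<in> D"
  shows "annotate \<Phi> t \<in> ann_terms S D"
  using assms
proof (induction t arbitrary: \<Phi>)
  case (Fun f ts)
  have "annotate {p. i # p \<in> \<Phi>} (ts ! i) \<in> ann_terms S D" if "i < length ts" for i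
  proof (rule Fun.IH)
    show "base g \<in> D" if "p \<in> {p. i # p \<in> \<Phi>}" "p \<in> poss (ts ! i)" "subterm_at (ts ! i) p = Fun g us" for p g us
      using Fun.prems(3)[of "i # p" g us] that \<open>i < length ts\<close> by simp
  qed (use Fun.prems that in \<open>auto simp: ann_terms_def\<close>)
  moreover have "base f \<in> D" if "[] \<in> \<Phi>"
    using Fun.prems(3)[OF that] by auto
  ultimately show ?case
    using Fun.prems(1,2) by (auto simp: ann_terms_def)
qed (auto simp: ann_terms_def)

lemma flat_plain_terms:
  assumes "t \<in> ann_terms S D" "D \<subseteq> symbols S"
  shows "flat t \<in> plain_terms S"
  using assms
proof (induction t)
  case (Fun f ts)
  then show ?case by (auto simp: ann_terms_def plain_terms_def)
qed (auto simp: ann_terms_def plain_terms_def)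

lemma flat_plain: "t \<in> plain_terms S \<Longrightarrow> flat t = t"
proof (induction t)
  case (Fun f ts)
  then show ?case by (auto simp: plain_terms_def intro!: nth_equalityI)
qed auto

text \<open>Substitutions map the variables of the signature to terms without annotations, which
  \<open>flat\<close> fixes; on other variables they are unconstrained, whence the condition on
  \<open>vars t\<close>.\<close>

lemma flat_subst:
  assumes "substitution S \<sigma>" "vars t \<subseteq> variables S"
  shows "flat (subst \<sigma> t) = subst \<sigma> (flat t)"
  using assms(2)
proof (induction t)
  case (Var x)
  with assms(1) show ?case by (auto simp: substitution_def intro: flat_plain)
next
  case (Fun f ts)
  then have "map flat (map (subst \<sigma>) ts) = map (subst \<sigma>) (map flat ts)" by auto
  then show ?case by simp
qed

lemma vars_flat [simp]: "vars (flat t) = vars t"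
  by (induction t) auto

subsection \<open>Steps with non-probabilistic ADPs\<close>

abbreviation ann_poss :: "'f set \<Rightarrow> ('f, 'v) aterm \<Rightarrow> pos set" where
  "ann_poss D t \<equiv> sym_poss (Ann ` D) t"

text \<open>The chain term that an annotated position represents: all annotations are dropped before
  the root gets its own back, so further annotations of \<open>s\<close> have no influence on
  it.\<close>

definition dp_at :: "('f, 'v) aterm \<Rightarrow> pos \<Rightarrow> ('f, 'v) aterm" where
  "dp_at s q = sharp (flat (subterm_at s q))"

section \<open>Effect of replacements on annotated positions and their chain terms\<close>

lemma sym_poss_poss: "p \<in> sym_poss X t \<Longrightarrow> p \<in> poss t"
  by (simp add: sym_poss_def)

lemma sym_poss_replace_at:
  assumes p: "p \<in> poss t" and np: "\<not> prefix p q"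
  shows "q \<in> sym_poss X (replace_at t p u) \<longleftrightarrow> q \<in> sym_poss X t"
proof (cases "q \<in> poss t")
  case True
  show ?thesis
  proof (cases "prefix q p")
    case True
    then obtain q' where q': "p = q @ q'" by (auto elim: prefixE)
    with np have "q' \<noteq> []" by auto
    have "subterm_at (replace_at t p u) q = replace_at (subterm_at t q) q' u"
      using p by (simp add: q' subterm_at_replace_at_above)
    moreover have "(\<exists>f ts. replace_at v q' u = Fun f ts \<and> f \<in> X) \<longleftrightarrow> (\<exists>f ts. v = Fun f ts \<and> f \<in> X)"
      if "q' \<in> poss v" for v
      using that \<open>q' \<noteq> []\<close> by (cases v; cases q') auto
    ultimately show ?thesis
      using p poss_replace_at[OF p np] by (simp add: sym_poss_def q')
  next
    case False
    with subterm_at_replace_at_parallel[OF p \<open>q \<in> poss t\<close> np] poss_replace_at[OF p np]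
    show ?thesis by (simp add: sym_poss_def)
  qed
next
  case False
  with poss_replace_at[OF p np] show ?thesis by (simp add: sym_poss_def)
qed

lemma sym_poss_replace_at_below:
  "p \<in> poss t \<Longrightarrow> p @ q \<in> sym_poss X (replace_at t p u) \<longleftrightarrow> q \<in> sym_poss X u"
  by (simp add: sym_poss_appendI)

lemma dp_at_annotate [simp]: "q \<in> poss t \<Longrightarrow> dp_at (annotate \<Phi> t) q = dp_at t q"
  by (simp add: dp_at_def subterm_at_annotate)

lemma dp_at_flat_above [simp]: "q \<in> poss t \<Longrightarrow> dp_at (flat_above D \<pi> t) q = dp_at t q"
  by (simp add: flat_above_def)

lemma dp_at_replace_at_parallel:
  assumes "p \<in> poss t" "q \<in> poss t" "\<not> prefix p q" "\<not> prefix q p"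
  shows "dp_at (replace_at t p u) q = dp_at t q"
  using assms by (simp add: dp_at_def subterm_at_replace_at_parallel)

text \<open>\<open>sharp\<close> changes only the root, so it commutes with a replacement strictly
  below the root; hence the condition \<open>q' \<noteq> []\<close>.\<close>

lemma dp_at_replace_at_above:
  assumes "q @ q' \<in> poss t" "q' \<noteq> []"
  shows "dp_at (replace_at t (q @ q') u) q = replace_at (dp_at t q) q' (flat u)"
  using assms by (simp add: dp_at_def subterm_at_replace_at_above flat_replace_at sharp_replace_at)

lemma dp_at_replace_at_below:
  assumes "p \<in> poss t"
  shows "dp_at (replace_at t p u) (p @ q) = dp_at u q"
  using assms by (simp add: dp_at_def)

lemma subterm_at_dp_at:
  assumes "q @ q' \<in> poss t" "q' \<noteq> []"
  shows "subterm_at (dp_at t q) q' = flat (subterm_at t (q @ q'))"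
  using assms by (simp add: dp_at_def subterm_at_sharp subterm_at_flat)

lemma poss_dp_at [simp]: "poss (dp_at t q) = poss (subterm_at t q)"
  by (simp add: dp_at_def)

section \<open>Steps with a single outcome and the origins of annotations\<close>

lemma rewrite_rootI:
  assumes "(l, r) \<in> R" "substitution S \<sigma>"
  shows "(subst \<sigma> l, subst \<sigma> r) \<in> rewrite S R"
proof -
  have "[] \<in> poss (subst \<sigma> l)" "subterm_at (subst \<sigma> l) [] = subst \<sigma> l"
    "subst \<sigma> r = replace_at (subst \<sigma> l) [] (subst \<sigma> r)"
    by simp_all
  with assms show ?thesis unfolding rewrite_def by blast
qed

text \<open>The three rewriting cases in one shape: the flag \<open>m\<close> decides whether
  annotations above the redex are erased, and the annotations of \<open>r\<close> are kept only at
  an annotated redex.\<close>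

lemma adp_step_singleE:
  assumes "adp_step S D (l, {#(1, r)#}, m) c s M"
  obtains \<phi> \<sigma> \<pi> \<Theta> where "redex S D l \<sigma> s \<pi>"
    and "\<And>\<rho> \<rho>'. \<rho> \<in> var_poss l \<Longrightarrow> \<phi> \<rho> = Some \<rho>' \<Longrightarrow>
           \<rho>' \<in> var_poss r \<and> subterm_at l \<rho> = subterm_at r \<rho>'"
    and "c \<in> {AT, AF} \<longleftrightarrow> \<pi> \<in> ann_poss D s"
    and "\<Theta> = Psi D l \<phi> (subterm_at s \<pi>) \<union> (if \<pi> \<in> ann_poss D s then ann_poss D r else {})"
    and "M = {#(1, (if m then id else flat_above D \<pi>) (replace_at s \<pi> (annotate \<Theta> (subst \<sigma> r))))#}"
  using assms
proof cases
  case (at rs \<phi> \<sigma> \<pi>)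
  have rs: "rs = [(1, r)]" using at(1) by simp
  show ?thesis
    by (rule that[of \<sigma> \<pi> "\<phi> 0"]) (use at rs in \<open>auto simp: vrf_def Phi_def Un_commute\<close>)
next
  case (af rs \<phi> \<sigma> \<pi>)
  have rs: "rs = [(1, r)]" using af(1) by simp
  show ?thesis
    by (rule that[of \<sigma> \<pi> "\<phi> 0"]) (use af rs in \<open>auto simp: vrf_def Phi_def Un_commute\<close>)
next
  case (nt rs \<phi> \<sigma> \<pi>)
  have rs: "rs = [(1, r)]" using nt(1) by simp
  show ?thesis
    by (rule that[of \<sigma> \<pi> "\<phi> 0"]) (use nt rs in \<open>auto simp: vrf_def\<close>)
qed

text \<open>The variable reposition function that is \<open>None\<close> everywhere makes
  \<open>Psi\<close> empty, so nothing is inherited from the redex. The simulation of chains uses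
  only such steps.\<close>

lemma adp_step_singleI:
  assumes "redex S D l \<sigma> s \<pi>" and "m \<or> \<pi> \<in> ann_poss D s"
    and "\<Theta> = (if \<pi> \<in> ann_poss D s then ann_poss D r else {})"
  shows "\<exists>c. (c \<in> {AT, AF} \<longleftrightarrow> \<pi> \<in> ann_poss D s) \<and>
    adp_step S D (l, {#(1, r)#}, m) c s
      {#(1, (if m then id else flat_above D \<pi>) (replace_at s \<pi> (annotate \<Theta> (subst \<sigma> r))))#}"
proof -
  let ?\<phi> = "\<lambda>_ _. None"
  have v: "vrf l [(1, r)] ?\<phi>" by (simp add: vrf_def)
  have Psi: "Psi D l (\<lambda>_. None) u = {}" for u by (simp add: Psi_def)
  show ?thesis
  proof (cases "\<pi> \<in> ann_poss D s")
    case True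
    then show ?thesis
      using adp_step.at[OF v assms(1) True] adp_step.af[OF v assms(1) True] assms(3)
      by (cases m) (auto simp: Phi_def Psi)
  next
    case False
    then show ?thesis
      using adp_step.nt[OF v assms(1) False] assms(2,3) by (auto simp: Psi intro!: exI[of _ NT])
  qed
qed

text \<open>Every annotated position of \<open>t\<close> stems from one of \<open>s\<close>. As variable repositioning does not
  duplicate, two positions have the same origin only if it was the annotated redex \<open>\<pi>\<close>.\<close>

definition origin_map where
  "origin_map S D P c s t \<pi> origin \<longleftrightarrow>
     (c \<in> {AT, AF} \<longrightarrow> \<pi> \<in> ann_poss D s) \<and>
     (\<forall>q \<in> ann_poss D t. origin q \<in> ann_poss D s \<and>
        (dp_at s (origin q), dp_at t q) \<in>
          (if c \<in> {AT, AF} \<and> origin q = \<pi> then rewrite S (dp D P) else (rewrite S (np P))\<^sup>=)) \<and>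
     (\<forall>q \<in> ann_poss D t. \<forall>q' \<in> ann_poss D t. origin q = origin q' \<longrightarrow>
        \<not> (c \<in> {AT, AF} \<and> origin q = \<pi>) \<longrightarrow> q = q')"

text \<open>An annotation of \<open>t\<close> outside the contracted part was there before. Inside,
  it comes either from \<open>r\<close>, and then its origin is the annotated redex, or from below a
  variable of \<open>l\<close> via \<open>\<phi>\<close>.\<close>

lemma adp_step_origin_map:
  assumes step: "adp_step S D (l, {#(1, r)#}, m) c s {#(1, t)#}"
    and P: "(l, {#(1, r)#}, m) \<in> P" and adp: "is_adp S D (l, {#(1, r)#}, m)"
  shows "\<exists>\<pi> origin. origin_map S D P c s t \<pi> origin"
proof -
  from step obtain \<phi> \<sigma> \<pi> \<Theta> where redex: "redex S D l \<sigma> s \<pi>"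
    and \<phi>: "\<And>\<rho> \<rho>'. \<rho> \<in> var_poss l \<Longrightarrow> \<phi> \<rho> = Some \<rho>' \<Longrightarrow>
           \<rho>' \<in> var_poss r \<and> subterm_at l \<rho> = subterm_at r \<rho>'"
    and c: "c \<in> {AT, AF} \<longleftrightarrow> \<pi> \<in> ann_poss D s"
    and \<Theta>: "\<Theta> = Psi D l \<phi> (subterm_at s \<pi>) \<union> (if \<pi> \<in> ann_poss D s then ann_poss D r else {})"
    and t: "t = (if m then id else flat_above D \<pi>) (replace_at s \<pi> (annotate \<Theta> (subst \<sigma> r)))"
    by (rule adp_step_singleE) auto
  from redex have \<sigma>: "substitution S \<sigma>" and \<pi>: "\<pi> \<in> poss s"
    and match: "flat (subterm_at s \<pi>) = subst \<sigma> l"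
    by (auto simp: redex_def sym_poss_def)
  from adp have l: "l \<in> plain_terms S" "\<nexists>x. l = Var x" and vars_rl: "vars r \<subseteq> vars l"
    by (auto simp: is_adp_def)
  then obtain f ls where lf: "l = Fun f ls" by (cases l) auto
  have vars: "vars r \<subseteq> variables S"
    using vars_rl vars_terms l(1) unfolding plain_terms_def by blast
  define s' where "s' = replace_at s \<pi> (annotate \<Theta> (subst \<sigma> r))"
  have dp_t: "dp_at t q = dp_at s' q" if "q \<in> ann_poss D t" for q
    using that sym_poss_poss[OF that] by (auto simp: t s'_def flat_above_def)
  \<comment> \<open>For false \<open>m\<close>, everything strictly above the redex loses its
    annotation. A surviving annotation there forces \<open>m\<close>, so that the rule is available
    in \<open>np P\<close>.\<close>
  have ann_t: "q \<in> ann_poss D s' \<and> (m \<or> \<not> strict_prefix q \<pi>)" if "q \<in> ann_poss D t" for q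
    using that by (auto simp: t s'_def sym_poss_flat_above split: if_splits)
  \<comment> \<open>The disjuncts treat positions neither at nor below the redex, annotations of
    \<open>r\<close>, and positions moved by \<open>\<phi>\<close>. With a relation their
    disjointness is no issue; an origin is chosen at the end.\<close>
  define orig where "orig q o' \<longleftrightarrow> \<not> prefix \<pi> q \<and> o' = q \<or>
     (\<pi> \<in> ann_poss D s \<and> o' = \<pi> \<and> (\<exists>q'. q = \<pi> @ q' \<and> q' \<in> ann_poss D r)) \<or>
     (\<exists>\<rho> \<rho>' \<tau>. \<rho> \<in> var_poss l \<and> \<phi> \<rho> = Some \<rho>' \<and> q = \<pi> @ \<rho>' @ \<tau> \<and> o' = \<pi> @ \<rho> @ \<tau> \<and>
        \<rho> @ \<tau> \<in> ann_poss D (subterm_at s \<pi>))" for q o'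
  have ex: "\<exists>o'. orig q o'" if "q \<in> ann_poss D t" for q
  proof (cases "prefix \<pi> q")
    case True
    then obtain q' where q': "q = \<pi> @ q'" by (auto elim: prefixE)
    with ann_t[OF that] have "q' \<in> ann_poss D (annotate \<Theta> (subst \<sigma> r))"
      using \<pi> by (simp add: s'_def sym_poss_replace_at_below)
    then have "q' \<in> \<Theta>" by (auto simp: sym_poss_annotate)
    then show ?thesis
      unfolding \<Theta> Psi_def orig_def q' by (auto split: if_splits)
  qed (auto simp: orig_def)
  have ann: "o' \<in> ann_poss D s" if "q \<in> ann_poss D t" "orig q o'" for q o'
    using that(2) unfolding orig_def
  proof (elim disjE conjE exE)
    assume "\<not> prefix \<pi> q" "o' = q"
    with ann_t[OF that(1)] show ?thesis
      using sym_poss_replace_at[OF \<pi>] by (auto simp: s'_def)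
  next
    fix \<rho> \<rho>' \<tau> assume "o' = \<pi> @ \<rho> @ \<tau>" "\<rho> @ \<tau> \<in> ann_poss D (subterm_at s \<pi>)"
    then show ?thesis using \<pi> by (simp add: sym_poss_appendI)
  qed auto
  have rel: "(dp_at s o', dp_at t q) \<in>
      (if c \<in> {AT, AF} \<and> o' = \<pi> then rewrite S (dp D P) else (rewrite S (np P))\<^sup>=)"
    if q: "q \<in> ann_poss D t" "orig q o'" for q o'
    using q(2) unfolding orig_def
  proof (elim disjE conjE exE)
    assume o': "\<not> prefix \<pi> q" "o' = q"
    then have "o' \<noteq> \<pi>" by auto
    have qs: "q \<in> poss s" using ann[OF q] o' sym_poss_poss by blast
    have "(dp_at s q, dp_at s' q) \<in> (rewrite S (np P))\<^sup>="
    proof (cases "prefix q \<pi>")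
      case False
      then show ?thesis
        using dp_at_replace_at_parallel[OF \<pi> qs o'(1)] by (simp add: s'_def)
    next
      case True
      then obtain q' where q': "\<pi> = q @ q'" by (auto elim: prefixE)
      with o' have ne: "q' \<noteq> []" by auto
      with q' ann_t[OF q(1)] have m by (auto simp: strict_prefix_def)
      with P have np: "(l, flat r) \<in> np P" by (auto simp: np_def)
      \<comment> \<open>Strictly above the redex, the chain term itself is rewritten with the
        flattened rule at \<open>q'\<close>.\<close>
      have "dp_at s' q = replace_at (dp_at s q) q' (subst \<sigma> (flat r))"
        using \<pi> ne flat_subst[OF \<sigma> vars] by (simp add: s'_def q' dp_at_replace_at_above)
      moreover have "subterm_at (dp_at s q) q' = subst \<sigma> l"
        using \<pi> ne match by (simp add: q' subterm_at_dp_at)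
      moreover have "q' \<in> poss (dp_at s q)" using \<pi> q' by simp
      ultimately show ?thesis
        using np \<sigma> unfolding rewrite_def by blast
    qed
    then show ?thesis using o' \<open>o' \<noteq> \<pi>\<close> dp_t[OF q(1)] by auto
  next
    fix q' assume A: "\<pi> \<in> ann_poss D s" "o' = \<pi>" "q = \<pi> @ q'" "q' \<in> ann_poss D r"
    from A(4) obtain g us where g: "q' \<in> poss r" "subterm_at r q' = Fun g us"
      by (auto simp: sym_poss_def)
    have "dp_at s' q = dp_at (subst \<sigma> r) q'"
      using \<pi> g by (simp add: s'_def A(3) dp_at_replace_at_below poss_subst)
    also have "\<dots> = sharp (flat (subst \<sigma> (subterm_at r q')))"
      using g(1) by (simp add: dp_at_def subterm_at_subst)
    also have "\<dots> = sharp (subst \<sigma> (flat (subterm_at r q')))"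
      using flat_subst[OF \<sigma> order_trans[OF vars_subterm_at[OF g(1)] vars]] by simp
    also have "\<dots> = subst \<sigma> (sharp (flat (subterm_at r q')))"
      by (simp add: g(2))
    finally have "dp_at s' q = subst \<sigma> (sharp (flat (subterm_at r q')))" .
    moreover have "dp_at s \<pi> = subst \<sigma> (sharp l)"
      by (simp add: dp_at_def match lf)
    moreover have "(sharp l, sharp (flat (subterm_at r q'))) \<in> dp D P"
      using P A(4) unfolding dp_def ann_subterm_def by blast
    ultimately have "(dp_at s \<pi>, dp_at s' q) \<in> rewrite S (dp D P)"
      using rewrite_rootI[OF _ \<sigma>] by metis
    then show ?thesis using A c dp_t[OF q(1)] by auto
  next
    fix \<rho> \<rho>' \<tau>
    assume B: "\<rho> \<in> var_poss l" "\<phi> \<rho> = Some \<rho>'" "q = \<pi> @ \<rho>' @ \<tau>" "o' = \<pi> @ \<rho> @ \<tau>"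
      "\<rho> @ \<tau> \<in> ann_poss D (subterm_at s \<pi>)"
    \<comment> \<open>As \<open>l\<close> is no variable, this origin differs from the redex, so a
      step in the reflexive closure for \<open>np P\<close> is required; the two chain terms turn
      out equal.\<close>
    from B(1) lf have "\<rho> \<noteq> []" by (auto simp: var_poss_def)
    from \<phi>[OF B(1,2)] B(1) obtain x where x: "\<rho>' \<in> poss r" "subterm_at r \<rho>' = Var x"
      "\<rho> \<in> poss l" "subterm_at l \<rho> = Var x"
      by (auto simp: var_poss_def)
    have ps: "\<rho> @ \<tau> \<in> poss (subterm_at s \<pi>)" using B(5) sym_poss_poss by blast
    have "flat (subterm_at s (\<pi> @ \<rho> @ \<tau>)) = subterm_at (flat (subterm_at s \<pi>)) (\<rho> @ \<tau>)"
      using \<pi> ps by (simp only: subterm_at_append subterm_at_flat)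
    also have "\<dots> = subterm_at (subst \<sigma> l) (\<rho> @ \<tau>)" by (simp only: match)
    also have "\<dots> = subterm_at (\<sigma> x) \<tau>"
      using x poss_subst[OF x(3), of \<sigma>] by (simp add: subterm_at_subst)
    finally have s: "flat (subterm_at s (\<pi> @ \<rho> @ \<tau>)) = subterm_at (\<sigma> x) \<tau>" .
    have "\<rho> @ \<tau> \<in> poss (subst \<sigma> l)"
      using ps match by (metis poss_flat)
    with x(3,4) have "\<tau> \<in> poss (\<sigma> x)" by (simp add: subterm_at_subst)
    then have pr: "\<rho>' @ \<tau> \<in> poss (subst \<sigma> r)"
      using x by (simp add: poss_subst subterm_at_subst)
    have "dp_at s' q = dp_at (subst \<sigma> r) (\<rho>' @ \<tau>)"
      using \<pi> pr by (simp only: s'_def B(3) dp_at_replace_at_below dp_at_annotate)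
    also have "\<dots> = sharp (flat (subterm_at (\<sigma> x) \<tau>))"
      using x poss_subst[OF x(1), of \<sigma>] by (simp add: dp_at_def subterm_at_subst)
    also have "\<dots> = dp_at s o'"
      unfolding s[symmetric] B(4) by (simp add: dp_at_def)
    finally show ?thesis using B(4) \<open>\<rho> \<noteq> []\<close> dp_t[OF q(1)] by simp
  qed
  \<comment> \<open>An origin neither at nor below the redex is the position itself. Otherwise the
    position was moved by \<open>\<phi>\<close>, which depends only on the variable position and
    keeps the rest \<open>\<tau>\<close>.\<close>
  have inj: "q = q'" if "orig q o'" "orig q' o'" "\<not> (c \<in> {AT, AF} \<and> o' = \<pi>)" for q q' o'
  proof (cases "prefix \<pi> o'")
    case False
    with that show ?thesis by (auto simp: orig_def)
  next
    case True
    with that c obtain \<rho> \<tau> p where q: "\<rho> \<in> var_poss l" "\<phi> \<rho> = Some p" "q = \<pi> @ p @ \<tau>" "o' = \<pi> @ \<rho> @ \<tau>"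
      unfolding orig_def by blast
    from True that c obtain \<rho>' \<tau>' p' where q': "\<rho>' \<in> var_poss l" "\<phi> \<rho>' = Some p'"
      "q' = \<pi> @ p' @ \<tau>'" "o' = \<pi> @ \<rho>' @ \<tau>'"
      unfolding orig_def by blast
    from q(4) q'(4) have eq: "\<rho> @ \<tau> = \<rho>' @ \<tau>'" by simp
    with var_poss_prefix_free[OF q(1) q'(1)] have "\<rho> = \<rho>'" by blast
    with eq q q' show ?thesis by simp
  qed
  from ex have "\<exists>origin. \<forall>q \<in> ann_poss D t. orig q (origin q)"
    by (intro bchoice) auto
  then obtain origin where origin: "\<And>q. q \<in> ann_poss D t \<Longrightarrow> orig q (origin q)" by blast
  then have "origin_map S D P c s t \<pi> origin"
    unfolding origin_map_def
  proof (intro conjI ballI impI)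
    show "\<pi> \<in> ann_poss D s" if "c \<in> {AT, AF}" using c that by blast
  next
    fix q assume q: "q \<in> ann_poss D t"
    from origin[OF q] have o: "orig q (origin q)" .
    show "origin q \<in> ann_poss D s" by (rule ann[OF q o])
    show "(dp_at s (origin q), dp_at t q) \<in>
        (if c \<in> {AT, AF} \<and> origin q = \<pi> then rewrite S (dp D P) else (rewrite S (np P))\<^sup>=)"
      by (rule rel[OF q o])
  next
    fix q q' assume "q \<in> ann_poss D t" "q' \<in> ann_poss D t" and eq: "origin q = origin q'"
      and no: "\<not> (c \<in> {AT, AF} \<and> origin q = \<pi>)"
    with origin[of q] origin[of q'] have "orig q (origin q)" "orig q' (origin q)" by simp_all
    then show "q = q'" using no by (rule inj)
  qed
  then show ?thesis by blast
qed

subsection \<open>Infinite sequences\<close>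

text \<open>A state pairs a term with the number of \<open>B\<close>-steps left before the next
  \<open>t i\<close>. At 0 an \<open>A\<close>-step is due and otherwise the number drops, so
  \<open>A\<close>-steps recur forever.\<close>

lemma flatten_relcomp_chain:
  assumes chain: "\<And>i :: nat. (t i, t (Suc i)) \<in> A O B\<^sup>*"
  obtains u b where "u 0 = t 0" and "\<And>k. (u k, u (Suc k)) \<in> (if b k then A else B)"
    and "infinite {k. b k}"
proof -
  define G where "G z \<longleftrightarrow> (\<exists>i. (fst z, t i) \<in> B ^^ snd z)" for z
  define next_state where "next_state z z' \<longleftrightarrow>
    (if snd z = 0 then (fst z, fst z') \<in> A else (fst z, fst z') \<in> B \<and> snd z = Suc (snd z'))" for z z'
  have step: "\<exists>z'. G z' \<and> next_state z z'" if "G z" for z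
  proof (cases z)
    case (Pair x n)
    from that obtain i where i: "(x, t i) \<in> B ^^ n" by (auto simp: G_def Pair)
    show ?thesis
    proof (cases n)
      case 0
      with i have "x = t i" by simp
      with chain[of i] obtain y n' where "(x, y) \<in> A" "(y, t (Suc i)) \<in> B ^^ n'"
        by (auto dest: rtrancl_imp_relpow)
      then show ?thesis by (intro exI[of _ "(y, n')"]) (auto simp: G_def next_state_def Pair 0)
    next
      case (Suc n')
      from i obtain y where "(x, y) \<in> B" "(y, t i) \<in> B ^^ n'"
        unfolding Suc by (rule relpow_Suc_E2)
      then show ?thesis by (intro exI[of _ "(y, n')"]) (auto simp: G_def next_state_def Pair Suc)
    qed
  qed
  have "\<exists>z. \<forall>k. (G (z k) \<and> (k = 0 \<longrightarrow> z k = (t 0, 0))) \<and> next_state (z k) (z (Suc k))"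
  proof (rule dependent_nat_choice)
    show "\<exists>z. G z \<and> (0 = (0 :: nat) \<longrightarrow> z = (t 0, 0))"
      by (rule exI[of _ "(t 0, 0)"]) (auto simp: G_def intro: exI[of _ 0])
  qed (use step in auto)
  then obtain z where z: "\<And>k. next_state (z k) (z (Suc k))" "z 0 = (t 0, 0)" by blast
  have "infinite {k. snd (z k) = 0}"
  proof
    assume "finite {k. snd (z k) = 0}"
    then obtain N where N: "\<And>k. snd (z k) = 0 \<Longrightarrow> k < N"
      using finite_nat_set_iff_bounded by auto
    have "snd (z (N + k)) + k = snd (z N)" for k
    proof (induction k)
      case (Suc k)
      have "snd (z (N + k)) \<noteq> 0" using N[of "N + k"] by auto
      with z(1)[of "N + k"] Suc show ?case by (auto simp: next_state_def)
    qed simp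
    from this[of "Suc (snd (z N))"] show False by simp
  qed
  with z show ?thesis
    by (intro that[of "\<lambda>k. fst (z k)" "\<lambda>k. snd (z k) = 0"]) (auto simp: next_state_def)
qed

text \<open>The selected terms are the sources of the \<open>A\<close>-steps; all steps in between
  lie in \<open>B\<^sup>=\<close>. Whatever precedes the first \<open>A\<close>-step is cut
  off.\<close>

lemma compress_to_relcomp_chain:
  assumes step: "\<And>k :: nat. (u k, u (Suc k)) \<in> (if b k then A else B\<^sup>=)"
    and inf: "infinite {k. b k}"
  obtains e :: "nat \<Rightarrow> nat" where "\<And>i. (u (e i), u (e (Suc i))) \<in> A O B\<^sup>*"
proof -
  define e where "e = enumerate {k. b k}"
  have "(u (e i), u (e (Suc i))) \<in> A O B\<^sup>*" for i
  proof -
    have "b (e i)" using enumerate_in_set[OF inf] by (auto simp: e_def)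
    with step[of "e i"] have A: "(u (e i), u (Suc (e i))) \<in> A" by simp
    have lt: "e i < e (Suc i)" using enumerate_step[OF inf] by (simp add: e_def)
    have between: "\<not> b k" if "e i < k" "k < e (Suc i)" for k
      using that not_less_Least[of k "\<lambda>s. s \<in> {k. b k} \<and> e i < s"]
      by (auto simp: e_def enumerate_Suc''[OF inf])
    have "k \<le> e (Suc i) \<Longrightarrow> (u (Suc (e i)), u k) \<in> B\<^sup>*" if "Suc (e i) \<le> k" for k
      using that
    proof (induction k rule: dec_induct)
      case (step k)
      with between[of k] assms(1)[of k] show ?case
        by (auto intro: rtrancl_into_rtrancl)
    qed simp
    with A lt show ?thesis by auto
  qed
  then show ?thesis by (rule that)
qed

text \<open>\<open>ancestor par d i x\<close> is the ancestor at level \<open>i\<close> of an element \<open>x\<close> of level \<open>i + d\<close>.\<close>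

primrec ancestor :: "(nat \<Rightarrow> 'a \<Rightarrow> 'a) \<Rightarrow> nat \<Rightarrow> nat \<Rightarrow> 'a \<Rightarrow> 'a" where
  "ancestor par 0 i x = x"
| "ancestor par (Suc d) i x = par i (ancestor par d (Suc i) x)"

text \<open>The branch keeps to elements with infinitely many marked descendants. Only marked elements
  may have several children, so between two marked elements there is no choice and the branch
  cannot miss the next one.\<close>

lemma branch_with_infinitely_many_marks:
  fixes N :: "nat \<Rightarrow> 'a set"
  assumes fin: "\<And>k. finite (N k)" and inf: "infinite {k. b k}"
    and mark: "\<And>k. b k \<Longrightarrow> mark k \<in> N k"
    and par: "\<And>k q. q \<in> N (Suc k) \<Longrightarrow> par k q \<in> N k"
    and inj: "\<And>k q q'. q \<in> N (Suc k) \<Longrightarrow> q' \<in> N (Suc k) \<Longrightarrow> par k q = par k q' \<Longrightarrow>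
                \<not> (b k \<and> par k q = mark k) \<Longrightarrow> q = q'"
  obtains q where "\<And>k. q k \<in> N k" and "\<And>k. par k (q (Suc k)) = q k"
    and "infinite {k. b k \<and> q k = mark k}"
proof -
  \<comment> \<open>These are distances from level \<open>i\<close>, one mark per level, so an
    infinite set means infinitely many marked descendants.\<close>
  define marked where "marked i q = {d. b (i + d) \<and> ancestor par d i (mark (i + d)) = q}" for i q
  define good where "good i q \<longleftrightarrow> q \<in> N i \<and> infinite (marked i q)" for i q
  have anc: "ancestor par d i x \<in> N i" if "x \<in> N (i + d)" for d i x
    using that by (induction d arbitrary: i) (auto intro: par)
  \<comment> \<open>Each level is finite, so infinitely many marks share an ancestor on it, as in
    Koenig's lemma.\<close>
  have pigeon: "\<exists>q. good i q \<and> infinite {d \<in> X. ancestor par d i (mark (i + d)) = q}"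
    if X: "infinite X" "\<And>d. d \<in> X \<Longrightarrow> b (i + d)" for X i
  proof -
    let ?f = "\<lambda>d. ancestor par d i (mark (i + d))"
    have "?f ` X \<subseteq> N i" using X(2) mark anc by auto
    with fin have "finite (?f ` X)" by (rule finite_subset[rotated])
    with pigeonhole_infinite[OF X(1)] obtain d where d: "d \<in> X" "infinite {a \<in> X. ?f a = ?f d}"
      by blast
    have "{a \<in> X. ?f a = ?f d} \<subseteq> marked i (?f d)" using X(2) by (auto simp: marked_def)
    then have "infinite (marked i (?f d))" using d(2) finite_subset by blast
    then have "good i (?f d)" using d(1) X(2) mark anc by (simp add: good_def)
    with d(2) show ?thesis by blast
  qed
  have "\<exists>q. \<forall>k. good k (q k) \<and> par k (q (Suc k)) = q k"
  proof (rule dependent_nat_choice)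
    show "\<exists>q. good 0 q" using pigeon[OF inf, of 0] by auto
  next
    fix q k assume "good k q"
    \<comment> \<open>Distances counted from the next level: only distance 0 is lost, so the set
      stays infinite.\<close>
    let ?X = "{d. Suc d \<in> marked k q}"
    have "marked k q \<subseteq> insert 0 (Suc ` ?X)"
      by (auto simp: image_iff) (metis not0_implies_Suc)
    with \<open>good k q\<close> have "infinite ?X"
      unfolding good_def by (meson finite_imageI finite_insert finite_subset)
    from pigeon[OF this, of "Suc k"] obtain q' where
      q': "good (Suc k) q'" "infinite {d \<in> ?X. ancestor par d (Suc k) (mark (Suc k + d)) = q'}"
      by (auto simp: marked_def)
    from q'(2) obtain d where "d \<in> ?X" "ancestor par d (Suc k) (mark (Suc k + d)) = q'"
      using infinite_imp_nonempty by blast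
    then have "par k q' = q" by (auto simp: marked_def)
    with q'(1) show "\<exists>q'. good (Suc k) q' \<and> par k q' = q" by blast
  qed
  then obtain q where q: "\<And>k. good k (q k)" "\<And>k. par k (q (Suc k)) = q k" by blast
  have qN: "q k \<in> N k" for k using q(1) by (simp add: good_def)
  \<comment> \<open>Induction on the distance to a marked descendant: unless \<open>q i\<close> is
    itself marked, it has no second child, so the branch moves towards that descendant.\<close>
  have hit: "\<exists>j \<ge> i. b j \<and> q j = mark j" if "d \<in> marked i (q i)" for d i
    using that
  proof (induction d arbitrary: i)
    case 0
    then show ?case by (auto simp: marked_def)
  next
    case (Suc d)
    let ?a = "ancestor par d (Suc i) (mark (Suc i + d))"
    from Suc.prems have d: "b (Suc i + d)" "par i ?a = par i (q (Suc i))"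
      by (auto simp: marked_def q(2))
    show ?case
    proof (cases "b i \<and> q i = mark i")
      case False
      from d have "?a = q (Suc i)"
        using False q(2)[of i] anc[OF mark[OF d(1)]] qN[of "Suc i"]
        by - (rule inj[where k = i], simp_all)
      with d have "d \<in> marked (Suc i) (q (Suc i))" by (simp add: marked_def)
      from Suc.IH[OF this] show ?thesis by (meson Suc_leD)
    qed auto
  qed
  have "\<exists>j \<ge> i. b j \<and> q j = mark j" for i
    using q(1)[of i] hit[of _ i] unfolding good_def by (metis ex_in_conv infinite_imp_nonempty)
  then have "infinite {k. b k \<and> q k = mark k}"
    by (simp add: infinite_nat_iff_unbounded_le)
  with qN q(2) show ?thesis by (rule that)
qed

subsection \<open>Chain trees\<close>

text \<open>A step changes only terms, so the probabilities of the successors of a node sum up as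
  those of the ADP used there.\<close>

lemma adp_step_probs:
  assumes "adp_step S D \<alpha> c s M"
  shows "image_mset fst M = image_mset fst (fst (snd \<alpha>))"
proof -
  have *: "map (\<lambda>j. fst (rs ! j)) [0..<length rs] = map fst rs" for rs :: "(real \<times> ('a, 'b) aterm) list"
    by (rule nth_equalityI) auto
  from assms show ?thesis
    by cases (simp_all add: multiset.map_comp comp_def * flip: mset_map)
qed

section \<open>Rooted trees and leaf probabilities\<close>

lemma directed_tree_parent_unique:
  assumes "directed_tree V E r" "(u, v) \<in> E" "(u', v) \<in> E"
  shows "u = u'"
proof -
  from assms have "v \<in> V - {r}" unfolding directed_tree_def by blast
  with assms show ?thesis unfolding directed_tree_def by blast
qed

text \<open>By uniqueness of parents, a cycle at \<open>v\<close> moves back along the path from the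
  root to \<open>v\<close> until it reaches the root, which has no incoming edge.\<close>

lemma directed_tree_acyclic:
  assumes "directed_tree V E r"
  shows "acyclic E"
proof (rule acyclicI, intro allI notI)
  fix v assume "(v, v) \<in> E\<^sup>+"
  then have "v \<in> V" using assms unfolding directed_tree_def
    by (meson SigmaD1 converse_tranclE subsetD)
  with assms have "(r, v) \<in> E\<^sup>*" by (simp add: directed_tree_def)
  then have "(r, r) \<in> E\<^sup>+"
  proof (induction rule: converse_rtrancl_induct)
    case base
    show ?case by fact
  next
    case (step y z)
    from step(3) obtain y' where y': "(z, y') \<in> E\<^sup>*" "(y', z) \<in> E"
      by (blast dest: tranclD2)
    have "y' = y" using directed_tree_parent_unique[OF assms y'(2) step(1)] .
    with y' step(1) show ?case by auto
  qed
  then show False using assms unfolding directed_tree_def by (blast dest: tranclD2)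
qed

text \<open>Going up from \<open>x\<close>, both paths follow the same unique parents, so the longer
  one passes through the end of the shorter one.\<close>

lemma directed_tree_comparable:
  assumes tree: "directed_tree V E r" and "(u, x) \<in> E\<^sup>*" "(v, x) \<in> E\<^sup>*"
  shows "(u, v) \<in> E\<^sup>* \<or> (v, u) \<in> E\<^sup>*"
  using assms(2,3)
proof (induction arbitrary: v rule: rtrancl_induct)
  case (step y z)
  show ?case
  proof (cases "v = z")
    case True
    with step(1,2) show ?thesis by auto
  next
    case False
    with step(4) obtain y' where y': "(v, y') \<in> E\<^sup>*" "(y', z) \<in> E"
      by (metis rtranclE)
    have "y' = y" using directed_tree_parent_unique[OF tree y'(2) step(2)] .
    with y' step.IH show ?thesis by auto
  qed
qed auto

text \<open>Well-founded induction from the leaves upwards: below each node lie finitely many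
  leaves, and their probabilities add up to that of the node. At the root, the infinite sum is
  therefore finite.\<close>

lemma leaf_prob_of_wf_tree:
  fixes T :: "('f, 'v) tree"
  assumes tree: "directed_tree (nodes T) (edges T) (root T)"
    and fin: "\<And>v. v \<in> nodes T \<Longrightarrow> finite (edges T `` {v})"
    and sum: "\<And>v. v \<in> inner T \<Longrightarrow> (\<Sum>w \<in> edges T `` {v}. prob T w) = prob T v"
    and wf: "wf ((edges T)\<inverse>)"
  shows "leaf_prob T = prob T (root T)"
proof -
  define E where "E = edges T"
  define L where "L v = E\<^sup>* `` {v} \<inter> leaves T" for v
  have EV: "E \<subseteq> nodes T \<times> nodes T" using tree unfolding directed_tree_def E_def by blast
  have acyclic: "acyclic E" using directed_tree_acyclic[OF tree] by (simp add: E_def)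
  have "v \<in> nodes T \<Longrightarrow> finite (L v) \<and> sum (prob T) (L v) = prob T v" for v
    using wf
  proof (induction v rule: wf_induct_rule)
    case (less v)
    show ?case
    proof (cases "v \<in> leaves T")
      case True
      then have "v \<notin> Domain E" by (auto simp: leaves_def E_def)
      with True have "L v = {v}" by (auto simp: L_def Not_Domain_rtrancl)
      then show ?thesis by simp
    next
      case False
      with less.prems have inner: "v \<in> inner T" by (auto simp: leaves_def inner_def)
      have L: "L v = (\<Union>w \<in> E `` {v}. L w)"
      proof (intro equalityI subsetI)
        fix x assume x: "x \<in> L v"
        with False have "(v, x) \<in> E\<^sup>*" "v \<noteq> x" by (auto simp: L_def)
        then obtain w where "(v, w) \<in> E" "(w, x) \<in> E\<^sup>*" by (metis converse_rtranclE)
        with x show "x \<in> (\<Union>w \<in> E `` {v}. L w)" by (auto simp: L_def)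
      next
        fix x assume "x \<in> (\<Union>w \<in> E `` {v}. L w)"
        then obtain w where "(v, w) \<in> E" "(w, x) \<in> E\<^sup>*" "x \<in> leaves T" by (auto simp: L_def)
        then show "x \<in> L v" by (simp add: L_def converse_rtrancl_into_rtrancl)
      qed
      have IH: "finite (L w) \<and> sum (prob T) (L w) = prob T w" if "w \<in> E `` {v}" for w
        using less.IH[of w] that EV by (auto simp: E_def)
      \<comment> \<open>If one child reached another one, the path would enter the latter through
        its parent \<open>v\<close> and thus close a cycle.\<close>
      have no: "(w, w') \<notin> E\<^sup>*" if "(v, w) \<in> E" "(v, w') \<in> E" "w \<noteq> w'" for w w'
      proof
        assume "(w, w') \<in> E\<^sup>*"
        with that(3) obtain u where u: "(w, u) \<in> E\<^sup>*" "(u, w') \<in> E"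
          by (blast elim: rtranclE)
        have "u = v"
          using directed_tree_parent_unique[OF tree[folded E_def] u(2) that(2)] .
        with rtrancl_into_trancl2[OF that(1) u(1)] have "(v, v) \<in> E\<^sup>+" by simp
        with acyclic show False by (auto simp: acyclic_def)
      qed
      have disj: "L w \<inter> L w' = {}" if "w \<in> E `` {v}" "w' \<in> E `` {v}" "w \<noteq> w'" for w w'
        using that no[of w w'] no[of w' w]
          directed_tree_comparable[OF tree[folded E_def], of w _ w']
        unfolding L_def by blast
      have "sum (prob T) (L v) = (\<Sum>w \<in> E `` {v}. sum (prob T) (L w))"
        unfolding L using fin[OF less.prems] IH disj
        by (intro sum.UNION_disjoint) (auto simp: E_def)
      also have "\<dots> = prob T v" using IH sum[OF inner] by (simp add: E_def)
      finally have "sum (prob T) (L v) = prob T v" .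
      moreover have "finite (L v)"
        unfolding L using IH fin[OF less.prems] by (intro finite_UN_I) (simp_all add: E_def)
      ultimately show ?thesis by blast
    qed
  qed
  moreover have "L (root T) = leaves T" "root T \<in> nodes T"
    using tree unfolding L_def E_def directed_tree_def leaves_def by auto
  ultimately show ?thesis
    by (metis infsum_finite leaf_prob_def)
qed

text \<open>Without infinite paths the converse edge relation is well-founded, and as the
  probabilities of an ADP sum to 1, each inner node passes its whole probability on to its
  children.\<close>

lemma leaf_prob_no_infinite_path:
  assumes ct: "chain_tree S P T rule" and adp: "\<forall>\<alpha> \<in> P. is_adp S D \<alpha>"
    and path: "\<nexists>path. \<forall>i. (path i, path (Suc i)) \<in> edges T"
  shows "leaf_prob T = 1"
proof -
  have "leaf_prob T = prob T (root T)"
  proof (rule leaf_prob_of_wf_tree)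
    show "wf ((edges T)\<inverse>)"
      using path by (simp add: wf_iff_no_infinite_down_chain)
  next
    fix v assume v: "v \<in> inner T"
    let ?W = "edges T `` {v}"
    from v ct have pv: "prob T v > 0" and fin: "finite ?W" and "rule v \<in> P"
      by (auto simp: chain_tree_def inner_def)
    from v ct obtain c where "adp_step S (defined P) (rule v) c (label T v)
        (image_mset (\<lambda>w. (prob T w / prob T v, label T w)) (mset_set ?W))"
      unfolding chain_tree_def by blast
    from adp_step_probs[OF this]
    have "image_mset (\<lambda>w. prob T w / prob T v) (mset_set ?W) = image_mset fst (fst (snd (rule v)))"
      by (simp add: multiset.map_comp comp_def)
    from arg_cong[OF this, of sum_mset]
    have "(\<Sum>w \<in> ?W. prob T w / prob T v) = sum_mset (image_mset fst (fst (snd (rule v))))"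
      by (simp add: sum_unfold_sum_mset)
    also have "\<dots> = 1"
      using adp \<open>rule v \<in> P\<close> by (cases "rule v") (auto simp: is_adp_def case_prod_unfold)
    finally show "(\<Sum>w \<in> ?W. prob T w) = prob T v"
      using pv by (simp flip: sum_divide_distrib)
  qed (use ct in \<open>auto simp: chain_tree_def\<close>)
  with ct show ?thesis by (simp add: chain_tree_def)
qed

text \<open>A repeated node would lie on a cycle. Injectivity turns finitely many nodes into
  finitely many indices of the path.\<close>

lemma infinite_path_inj:
  assumes "directed_tree V E r" "\<And>i :: nat. (path i, path (Suc i)) \<in> E"
  shows "inj path"
proof -
  have "(path i, path (i + Suc d)) \<in> E\<^sup>+" for i d
    by (induction d) (use assms(2) in \<open>auto intro: trancl_into_trancl\<close>)
  then have "path i \<noteq> path j" if "i < j" for i j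
    using that directed_tree_acyclic[OF assms(1)] unfolding acyclic_def
    by (metis less_iff_Suc_add add_Suc_right)
  then show ?thesis by (metis injI linorder_neqE_nat)
qed

section \<open>Defined symbols and well-formed chain terms\<close>

lemma defined_subset_symbols:
  assumes "\<forall>\<alpha> \<in> P. is_adp S D \<alpha>"
  shows "defined P \<subseteq> symbols S"
  using assms by (fastforce simp: defined_def is_adp_def plain_terms_def)

lemma is_adp_lhsE:
  assumes "is_adp S D (l, \<mu>, m)" "(l, \<mu>, m) \<in> P"
  obtains f ts where "l = Fun (Sym f) ts" "f \<in> defined P"
proof (cases l)
  case (Fun g ts)
  with assms obtain f where "g = Sym f" by (auto simp: is_adp_def plain_terms_def)
  with Fun assms(2) show ?thesis by (intro that) (auto simp: defined_def)
qed (use assms in \<open>auto simp: is_adp_def\<close>)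

lemma dp_at_in_sharp_terms:
  assumes "s \<in> ann_terms S D" "D \<subseteq> symbols S" "q \<in> ann_poss D s"
  shows "dp_at s q \<in> sharp_terms S D"
proof -
  from assms(3) obtain f ts where q: "q \<in> poss s" "subterm_at s q = Fun (Ann f) ts" "f \<in> D"
    by (auto simp: sym_poss_def)
  have "subterm_at s q \<in> ann_terms S D"
    using assms(1) q(1) unfolding ann_terms_def by (rule subterm_at_terms)
  from flat_plain_terms[OF this assms(2)] q(2,3) show ?thesis
    unfolding sharp_terms_def dp_at_def
    by (intro CollectI exI[of _ "flat (subterm_at s q)"]) auto
qed

subsection \<open>From chain trees to chains\<close>

text \<open>The annotated positions of \<open>s k\<close> are level \<open>k\<close> of the forest,
  with origins as parents and annotated redexes as marks. A branch through infinitely many marks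
  yields a \<open>dp\<close> step at each mark, and \<open>np\<close> steps or equalities
  elsewhere.\<close>

lemma adp_path_imp_dp_nonterminating:
  fixes s :: "nat \<Rightarrow> ('f, 'v) aterm"
  assumes D: "D \<subseteq> symbols S"
    and P: "\<And>\<alpha>. \<alpha> \<in> P \<Longrightarrow> is_adp S D \<alpha> \<and> (\<exists>l r m. \<alpha> = (l, {#(1, r)#}, m))"
    and s: "\<And>k. s k \<in> ann_terms S D"
    and step: "\<And>k. rule k \<in> P \<and> adp_step S D (rule k) (c k) (s k) {#(1, s (Suc k))#}"
    and inf: "infinite {k. c k \<in> {AT, AF}}"
  shows "\<not> dp_terminating S D (dp D P, np P)"
proof -
  have "\<forall>k. \<exists>\<pi> origin. origin_map S D P (c k) (s k) (s (Suc k)) \<pi> origin"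
  proof
    fix k
    from step[of k] P obtain l r m where k: "rule k = (l, {#(1, r)#}, m)" by blast
    from step[of k] P[of "rule k"]
    show "\<exists>\<pi> origin. origin_map S D P (c k) (s k) (s (Suc k)) \<pi> origin"
      unfolding k by - (rule adp_step_origin_map, simp_all)
  qed
  then obtain \<pi> origin
    where om: "\<And>k. origin_map S D P (c k) (s k) (s (Suc k)) (\<pi> k) (origin k)"
    unfolding choice_iff by blast
  have \<pi>: "\<pi> k \<in> ann_poss D (s k)" if "c k \<in> {AT, AF}" for k
    using om[of k] that unfolding origin_map_def by blast
  have origin: "origin k q \<in> ann_poss D (s k)" if "q \<in> ann_poss D (s (Suc k))" for k q
    using om[of k] that unfolding origin_map_def by blast
  have rel: "(dp_at (s k) (origin k q), dp_at (s (Suc k)) q) \<in>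
        (if c k \<in> {AT, AF} \<and> origin k q = \<pi> k then rewrite S (dp D P) else (rewrite S (np P))\<^sup>=)"
    if "q \<in> ann_poss D (s (Suc k))" for k q
    using om[of k] that unfolding origin_map_def by blast
  have inj: "q = q'" if "q \<in> ann_poss D (s (Suc k))" "q' \<in> ann_poss D (s (Suc k))"
      "origin k q = origin k q'" "\<not> (c k \<in> {AT, AF} \<and> origin k q = \<pi> k)" for k q q'
    using om[of k] that unfolding origin_map_def by blast
  obtain q where q: "\<And>k. q k \<in> ann_poss D (s k)" "\<And>k. origin k (q (Suc k)) = q k"
    and inf': "infinite {k. c k \<in> {AT, AF} \<and> q k = \<pi> k}"
    using finite_sym_poss inf \<pi> origin inj
    by (rule branch_with_infinitely_many_marks[where N = "\<lambda>k. ann_poss D (s k)" and mark = \<pi>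
        and par = origin and b = "\<lambda>k. c k \<in> {AT, AF}"]) (assumption | blast)+
  define u where "u k = dp_at (s k) (q k)" for k
  have "(u k, u (Suc k)) \<in>
      (if c k \<in> {AT, AF} \<and> q k = \<pi> k then rewrite S (dp D P) else (rewrite S (np P))\<^sup>=)" for k
    using rel[OF q(1)[of "Suc k"]] unfolding q(2) u_def .
  then obtain e :: "nat \<Rightarrow> nat" where
    "\<And>i. (u (e i), u (e (Suc i))) \<in> rewrite S (dp D P) O (rewrite S (np P))\<^sup>*"
    by (rule compress_to_relcomp_chain[OF _ inf']) blast
  moreover have "u k \<in> sharp_terms S D" for k
    unfolding u_def using s D q(1) by (rule dp_at_in_sharp_terms)
  ultimately show ?thesis
    unfolding dp_terminating_def by (auto intro!: exI[of _ "\<lambda>i. u (e i)"])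
qed

text \<open>Serves both claims, AST being the case \<open>I = {}\<close>. An infinite path
  eventually leaves the finitely many nodes with ADPs of \<open>I - P\<close>, and all ADPs on its
  tail have a single outcome.\<close>

lemma chain_tree_leaf_prob:
  fixes I P :: "('f, 'v) adp set"
  assumes ct: "chain_tree S (I \<union> P) T rule"
    and adp: "\<forall>\<alpha> \<in> I \<union> P. is_adp S (defined (I \<union> P)) \<alpha>"
    and single: "\<forall>\<alpha> \<in> P. \<exists>l r m. \<alpha> = (l, {#(1, r)#}, m)"
    and fin: "finite {v \<in> inner T. rule v \<in> I - P}"
    and sn: "dp_terminating S (defined (I \<union> P)) (dp (defined (I \<union> P)) P, np P)"
  shows "leaf_prob T = 1"
proof (rule leaf_prob_no_infinite_path[OF ct adp], rule notI, elim exE)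
  fix path assume path: "\<forall>i. (path i, path (Suc i)) \<in> edges T"
  define D where "D = defined (I \<union> P)"
  have tree: "directed_tree (nodes T) (edges T) (root T)" using ct by (simp add: chain_tree_def)
  then have inner: "path i \<in> inner T" for i
    using path unfolding inner_def directed_tree_def by blast
  have "finite (path -` {v \<in> inner T. rule v \<in> I - P})"
    using fin infinite_path_inj[OF tree] path by (intro finite_vimageI) auto
  then obtain n where n: "\<And>i. path i \<in> inner T \<Longrightarrow> rule (path i) \<in> I - P \<Longrightarrow> i < n"
    using finite_nat_set_iff_bounded by auto
  define v where "v k = path (n + k)" for k
  have v: "v k \<in> inner T" "(v k, v (Suc k)) \<in> edges T" for k
    using inner path by (simp_all add: v_def)
  have rule_P: "rule (v k) \<in> P" for k
  proof -
    have "rule (v k) \<in> I \<union> P" using v(1) ct by (auto simp: chain_tree_def)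
    with n[of "n + k"] inner show ?thesis by (auto simp: v_def)
  qed
  have "\<exists>c. (c \<in> {AT, AF} \<longleftrightarrow> v k \<in> A_nodes T) \<and>
      adp_step S D (rule (v k)) c (label T (v k)) {#(1, label T (v (Suc k)))#}" for k
  proof -
    let ?M = "image_mset (\<lambda>w. (prob T w / prob T (v k), label T w)) (mset_set (edges T `` {v k}))"
    from v(1)[of k] ct obtain c where c: "c \<in> {AT, AF} \<longleftrightarrow> v k \<in> A_nodes T"
      "adp_step S D (rule (v k)) c (label T (v k)) ?M"
      unfolding chain_tree_def D_def by blast
    from single rule_P[of k] obtain l r m where "rule (v k) = (l, {#(1, r)#}, m)" by blast
    \<comment> \<open>The result has only one element, so it must be the label of the next node on
      the path.\<close>
    with c(2) obtain t where M: "?M = {#(1, t)#}" by (auto elim: adp_step_singleE)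
    have "finite (edges T `` {v k})" using v(1)[of k] ct by (auto simp: chain_tree_def inner_def)
    then have "(prob T (v (Suc k)) / prob T (v k), label T (v (Suc k))) \<in># ?M"
      using v(2)[of k] by auto
    then have "label T (v (Suc k)) = t" unfolding M by simp
    with c M show ?thesis by auto
  qed
  then obtain c where c: "\<And>k. c k \<in> {AT, AF} \<longleftrightarrow> v k \<in> A_nodes T"
    and step: "\<And>k. adp_step S D (rule (v k)) (c k) (label T (v k)) {#(1, label T (v (Suc k)))#}"
    by metis
  have "infinite (range v \<inter> A_nodes T)"
    using v(2) ct by (simp add: chain_tree_def)
  moreover have "range v \<inter> A_nodes T = v ` {k. c k \<in> {AT, AF}}"
    using c by auto
  ultimately have inf: "infinite {k. c k \<in> {AT, AF}}" by auto
  have "\<not> dp_terminating S D (dp D P, np P)"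
  proof (rule adp_path_imp_dp_nonterminating[where s = "\<lambda>k. label T (v k)" and rule = "\<lambda>k. rule (v k)"])
    show "D \<subseteq> symbols S" unfolding D_def using adp by (rule defined_subset_symbols)
    show "label T (v k) \<in> ann_terms S D" for k
      using v(1)[of k] ct by (auto simp: chain_tree_def inner_def D_def)
  qed (use adp single step rule_P inf in \<open>auto simp: D_def\<close>)
  with sn show False by (simp add: D_def)
qed

subsection \<open>From chains to chain trees\<close>

lemma adp_result_ann_terms:
  assumes "s \<in> ann_terms S D" "D \<subseteq> symbols S" "\<pi> \<in> poss s" "substitution S \<sigma>" "r \<in> ann_terms S D"
    and "\<Theta> \<subseteq> ann_poss D r"
  shows "(if m then id else flat_above D \<pi>) (replace_at s \<pi> (annotate \<Theta> (subst \<sigma> r))) \<in> ann_terms S D"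
proof -
  have "annotate \<Theta> (subst \<sigma> r) \<in> ann_terms S D"
  proof (rule annotate_ann_terms)
    show "subst \<sigma> r \<in> ann_terms S D" using assms(4,5) by (simp add: subst_ann_terms)
    show "base f \<in> D" if p: "p \<in> \<Theta>" "subterm_at (subst \<sigma> r) p = Fun f ts" for p f ts
    proof -
      from p(1) assms(6) obtain d us where "p \<in> poss r" "subterm_at r p = Fun (Ann d) us" "d \<in> D"
        by (auto simp: sym_poss_def)
      with p(2) show ?thesis by (auto simp: subterm_at_subst)
    qed
  qed fact
  with assms(1,3) have s': "replace_at s \<pi> (annotate \<Theta> (subst \<sigma> r)) \<in> ann_terms S D"
    unfolding ann_terms_def by (simp add: replace_at_terms)
  moreover have "flat_above D \<pi> u \<in> ann_terms S D" if "u \<in> ann_terms S D" for u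
    unfolding flat_above_def using that assms(2)
    by (rule annotate_ann_terms) (auto simp: sym_poss_def)
  ultimately show ?thesis by simp
qed

text \<open>The invariant of the simulation: the chain term is read off at one tracked position
  \<open>p\<close>, while the context of \<open>p\<close> and all further annotations are left
  open.\<close>

definition simulates where
  "simulates S D s p t \<longleftrightarrow> s \<in> ann_terms S D \<and> p \<in> ann_poss D s \<and> dp_at s p = t"

text \<open>\<open>b\<close> says whether a node with this step belongs to
  \<open>A_nodes\<close>.\<close>

definition adp_rel where
  "adp_rel S P b s s' \<longleftrightarrow> (\<exists>\<alpha> \<in> P. \<exists>c. (c \<in> {AT, AF} \<longleftrightarrow> b) \<and>
     adp_step S (defined P) \<alpha> c s {#(1, s')#})"

text \<open>Rewriting at \<open>p\<close> leaves the right-hand side of the pair at an annotated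
  position \<open>q\<close> of the instance of \<open>r\<close>, so the tracked position moves from
  \<open>p\<close> to \<open>p @ q\<close>.\<close>

lemma simulate_dp:
  assumes P: "\<forall>\<alpha> \<in> P. is_adp S D \<alpha>" and D: "D = defined P"
    and sim: "simulates S D s p t" and tu: "(t, u) \<in> rewrite S (dp D P)"
  shows "\<exists>s' p'. simulates S D s' p' u \<and> adp_rel S P True s s'"
proof -
  from sim have s: "s \<in> ann_terms S D" and p: "p \<in> ann_poss D s" and t: "dp_at s p = t"
    by (auto simp: simulates_def)
  from p have ps: "p \<in> poss s" by (rule sym_poss_poss)
  from tu obtain l r m q \<sigma> \<rho> where lr: "(l, {#(1, r)#}, m) \<in> P" and q: "q \<in> ann_poss D r"
    and \<sigma>: "substitution S \<sigma>" and \<rho>: "\<rho> \<in> poss t"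
    "subterm_at t \<rho> = subst \<sigma> (sharp l)"
    and u: "u = replace_at t \<rho> (subst \<sigma> (sharp (flat (subterm_at r q))))"
    unfolding rewrite_def dp_def ann_subterm_def by auto
  from lr P have adp: "is_adp S D (l, {#(1, r)#}, m)" by blast
  then obtain f ls where l: "l = Fun (Sym f) ls" "f \<in> D" using lr D by (auto elim: is_adp_lhsE)
  have r: "r \<in> ann_terms S D" using adp by (simp add: is_adp_def)
  then have vars: "vars r \<subseteq> variables S" unfolding ann_terms_def by (rule vars_terms)
  \<comment> \<open>Below its root a chain term carries no annotation, whereas the root of
    \<open>sharp l\<close> is annotated.\<close>
  have "\<rho> = []"
  proof (rule ccontr)
    assume ne: "\<rho> \<noteq> []"
    have "p @ \<rho> \<in> poss s" using ps \<rho>(1) t by auto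
    then have "subterm_at t \<rho> = flat (subterm_at s (p @ \<rho>))"
      using ne subterm_at_dp_at t by blast
    with \<rho>(2) l(1) show False by (cases "subterm_at s (p @ \<rho>)") auto
  qed
  with \<rho> u have t': "t = subst \<sigma> (sharp l)"
    and u': "u = subst \<sigma> (sharp (flat (subterm_at r q)))" by simp_all
  have "flat (subterm_at s p) = subst \<sigma> l"
    using t t' l(1) by (cases "subterm_at s p") (auto simp: dp_at_def)
  with s \<sigma> p have redex: "redex S D l \<sigma> s p"
    by (auto simp: redex_def sym_poss_def)
  define s1 where "s1 = replace_at s p (annotate (ann_poss D r) (subst \<sigma> r))"
  define s' where "s' = (if m then id else flat_above D p) s1"
  obtain c where "c \<in> {AT, AF}" "adp_step S D (l, {#(1, r)#}, m) c s {#(1, s')#}"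
    using adp_step_singleI[OF redex, of m "ann_poss D r" r] p unfolding s'_def s1_def by auto
  with lr have "adp_rel S P True s s'" unfolding adp_rel_def D by blast
  moreover have "s' \<in> ann_terms S D"
    unfolding s'_def s1_def using s _ ps \<sigma> r order_refl
    by (rule adp_result_ann_terms) (use P in \<open>simp add: D defined_subset_symbols\<close>)
  moreover from q obtain g us where g: "q \<in> poss r" "subterm_at r q = Fun (Ann g) us" "g \<in> D"
    by (auto simp: sym_poss_def)
  have qs: "q \<in> poss (subst \<sigma> r)" using g(1) by (rule poss_subst)
  have "q \<in> ann_poss D (annotate (ann_poss D r) (subst \<sigma> r))"
    using q g qs by (simp add: sym_poss_annotate subterm_at_subst)
  then have "p @ q \<in> ann_poss D s1" unfolding s1_def using ps by (simp add: sym_poss_replace_at_below)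
  \<comment> \<open>\<open>flat_above\<close> erases annotations strictly above \<open>p\<close>
    only, so \<open>p @ q\<close> survives for either value of \<open>m\<close>.\<close>
  then have pq: "p @ q \<in> ann_poss D s'" by (auto simp: s'_def sym_poss_flat_above strict_prefix_def prefix_def)
  moreover have "dp_at s' (p @ q) = u"
  proof -
    have "dp_at s' (p @ q) = dp_at s1 (p @ q)"
      using sym_poss_poss[OF \<open>p @ q \<in> ann_poss D s1\<close>] by (simp add: s'_def)
    also have "\<dots> = dp_at (subst \<sigma> r) q"
      using ps qs by (simp add: s1_def dp_at_replace_at_below)
    also have "\<dots> = sharp (flat (subst \<sigma> (subterm_at r q)))"
      using g(1) by (simp add: dp_at_def subterm_at_subst)
    also have "\<dots> = sharp (subst \<sigma> (flat (subterm_at r q)))"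
      using flat_subst[OF \<sigma> order_trans[OF vars_subterm_at[OF g(1)] vars]] by simp
    also have "\<dots> = u" by (simp add: g(2) u')
    finally show ?thesis .
  qed
  ultimately show ?thesis unfolding simulates_def by blast
qed

text \<open>The rules of \<open>np P\<close> come from ADPs with flag true, so a step below
  \<open>p\<close> keeps the annotation at \<open>p\<close>. The redex may or may not be annotated,
  so \<open>b\<close> is left existential.\<close>

lemma simulate_np:
  assumes P: "\<forall>\<alpha> \<in> P. is_adp S D \<alpha>" and D: "D = defined P"
    and sim: "simulates S D s p t" and tu: "(t, u) \<in> rewrite S (np P)"
  shows "\<exists>s' b. simulates S D s' p u \<and> adp_rel S P b s s'"
proof -
  from sim have s: "s \<in> ann_terms S D" and p: "p \<in> ann_poss D s" and t: "dp_at s p = t"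
    by (auto simp: simulates_def)
  from p have ps: "p \<in> poss s" by (rule sym_poss_poss)
  from tu obtain l r \<sigma> \<rho> where lr: "(l, {#(1, r)#}, True) \<in> P"
    and \<sigma>: "substitution S \<sigma>" and \<rho>: "\<rho> \<in> poss t" "subterm_at t \<rho> = subst \<sigma> l"
    and u: "u = replace_at t \<rho> (subst \<sigma> (flat r))"
    unfolding rewrite_def np_def by auto
  from lr P have adp: "is_adp S D (l, {#(1, r)#}, True)" by blast
  then obtain f ls where l: "l = Fun (Sym f) ls" "f \<in> D" using lr D by (auto elim: is_adp_lhsE)
  have r: "r \<in> ann_terms S D" using adp by (simp add: is_adp_def)
  then have vars: "vars r \<subseteq> variables S" unfolding ann_terms_def by (rule vars_terms)
  \<comment> \<open>The root of the chain term is annotated, that of \<open>l\<close> is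
    not.\<close>
  have ne: "\<rho> \<noteq> []"
  proof
    assume "\<rho> = []"
    with \<rho>(2) l(1) t show False by (cases "subterm_at s p") (auto simp: dp_at_def)
  qed
  have pr: "p @ \<rho> \<in> poss s" using ps \<rho>(1) t by auto
  have match: "flat (subterm_at s (p @ \<rho>)) = subst \<sigma> l"
    using subterm_at_dp_at[OF pr ne] t \<rho>(2) by simp
  obtain h hs where h: "subterm_at s (p @ \<rho>) = Fun h hs" "base h = f"
    using match l(1) by (cases "subterm_at s (p @ \<rho>)") auto
  then have "h \<in> Sym ` D \<union> Ann ` D" using l(2) by (cases h) auto
  with s \<sigma> pr match h(1) have redex: "redex S D l \<sigma> s (p @ \<rho>)"
    unfolding redex_def sym_poss_def by blast
  define \<Theta> where "\<Theta> = (if p @ \<rho> \<in> ann_poss D s then ann_poss D r else {})"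
  define s' where "s' = replace_at s (p @ \<rho>) (annotate \<Theta> (subst \<sigma> r))"
  obtain c where "adp_step S D (l, {#(1, r)#}, True) c s {#(1, s')#}"
    using adp_step_singleI[OF redex _ \<Theta>_def, of True] unfolding s'_def by auto
  with lr have "\<exists>b. adp_rel S P b s s'" unfolding adp_rel_def D by blast
  moreover have "s' \<in> ann_terms S D"
    using adp_result_ann_terms[OF s _ pr \<sigma> r, of \<Theta> True] defined_subset_symbols[OF P]
    by (simp add: s'_def D \<Theta>_def)
  moreover have "p \<in> ann_poss D s'"
    unfolding s'_def using p ne sym_poss_replace_at[OF pr] by simp
  moreover have "dp_at s' p = u"
    unfolding s'_def dp_at_replace_at_above[OF pr ne] u t
    using flat_subst[OF \<sigma> vars] by simp
  ultimately show ?thesis unfolding simulates_def by blast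
qed

text \<open>The natural numbers with successor edges form a tree without leaves, whose leaf
  probability is the empty sum 0.\<close>

lemma infinite_path_not_AST:
  assumes s: "\<And>k. s k \<in> ann_terms S (defined P)"
    and step: "\<And>k. adp_rel S P (b k) (s k) (s (Suc k))"
    and inf: "infinite {k. b k}"
  shows "\<not> AST S P"
proof -
  from step obtain rule c where rule: "\<And>k. rule k \<in> P" "\<And>k. c k \<in> {AT, AF} \<longleftrightarrow> b k"
    "\<And>k. adp_step S (defined P) (rule k) (c k) (s k) {#(1, s (Suc k))#}"
    unfolding adp_rel_def by metis
  define T where "T = \<lparr>nodes = UNIV, edges = {(i, Suc i) | i. True}, root = 0,
    prob = (\<lambda>_. 1), label = s, A_nodes = {k. b k}\<rparr>"
  have succ: "edges T `` {v} = {Suc v}" for v by (auto simp: T_def)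
  have inner: "inner T = UNIV" and leaves: "leaves T = {}"
    by (simp_all add: inner_def leaves_def succ) (simp add: T_def)
  have reach: "(0, v) \<in> (edges T)\<^sup>*" for v
  proof (induction v)
    case (Suc v)
    moreover have "(v, Suc v) \<in> edges T" by (simp add: T_def)
    ultimately show ?case by (rule rtrancl_into_rtrancl)
  qed simp
  have parent: "\<exists>!u. (u, v) \<in> edges T" if "v \<noteq> 0" for v
    using that by (cases v) (auto simp: T_def)
  have tree: "directed_tree (nodes T) (edges T) (root T)"
    unfolding directed_tree_def using reach parent by (simp add: T_def)
  have path: "infinite (range path \<inter> A_nodes T)" if "\<forall>i. (path i, path (Suc i)) \<in> edges T"
    for path :: "nat \<Rightarrow> nat"
  proof -
    have A: "A_nodes T = {k. b k}" by (simp add: T_def)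
    \<comment> \<open>An infinite path visits all numbers from its start on, hence all but finitely
      many elements of \<open>A_nodes\<close>.\<close>
    have "path i = path 0 + i" for i
      by (induction i) (use that in \<open>auto simp: T_def\<close>)
    then have "path (k - path 0) = k" if "path 0 \<le> k" for k
      using that by (metis le_add_diff_inverse)
    then have "k \<in> range path" if "path 0 \<le> k" for k
      using that by (metis rangeI)
    then have "{k. b k} \<subseteq> {..< path 0} \<union> (range path \<inter> A_nodes T)"
      unfolding A lessThan_def using not_le_imp_less by blast
    with inf show ?thesis by (meson finite_UnI finite_lessThan finite_subset)
  qed
  have "chain_tree S P T rule"
    unfolding chain_tree_def succ inner
  proof (intro conjI ballI allI impI)
    fix v
    show "\<exists>c. (c \<in> {AT, AF} \<longleftrightarrow> v \<in> A_nodes T) \<and>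
        adp_step S (defined P) (rule v) c (label T v)
          (image_mset (\<lambda>w. (prob T w / prob T v, label T w)) (mset_set {Suc v}))"
      using rule(2)[of v] rule(3)[of v] by (intro exI[of _ "c v"]) (simp add: T_def)
  qed (use tree path rule(1) s in \<open>simp_all add: T_def\<close>)
  moreover have "leaf_prob T = 0" by (simp add: leaf_prob_def leaves)
  ultimately show ?thesis unfolding AST_def by (metis zero_neq_one)
qed

lemma dp_nonterminating_imp_not_AST:
  assumes P: "\<forall>\<alpha> \<in> P. is_adp S (defined P) \<alpha>"
    and nt: "\<not> dp_terminating S (defined P) (dp (defined P) P, np P)"
  shows "\<not> AST S P"
proof -
  define D where "D = defined P"
  have P': "\<forall>\<alpha> \<in> P. is_adp S D \<alpha>" using P by (simp add: D_def)
  from nt obtain t where t: "\<And>i :: nat. t i \<in> sharp_terms S D"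
    "\<And>i. (t i, t (Suc i)) \<in> rewrite S (dp D P) O (rewrite S (np P))\<^sup>*"
    unfolding dp_terminating_def D_def by auto
  from t(2) obtain u b where u: "u 0 = t 0"
    "\<And>k :: nat. (u k, u (Suc k)) \<in> (if b k then rewrite S (dp D P) else rewrite S (np P))"
    and inf: "infinite {k. b k}"
    by (rule flatten_relcomp_chain) blast
  \<comment> \<open>A simulated \<open>np\<close> step may hit an annotated redex too, so
    \<open>b k\<close> only implies the flag of the step; this suffices for infinitely many nodes in
    \<open>A_nodes\<close>.\<close>
  have "\<exists>z. \<forall>k. simulates S D (fst (z k)) (snd (z k)) (u k) \<and>
      (\<exists>c. adp_rel S P c (fst (z k)) (fst (z (Suc k))) \<and> (b k \<longrightarrow> c))"
  proof (rule dependent_nat_choice)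
    \<comment> \<open>The simulation starts with \<open>t 0\<close> itself, tracked at the
      root.\<close>
    from t(1)[of 0] obtain f ts where v: "Fun (Sym f) ts \<in> plain_terms S" "f \<in> D"
      "t 0 = Fun (Ann f) ts"
      by (auto simp: sharp_terms_def)
    have "D \<subseteq> symbols S" unfolding D_def using P by (rule defined_subset_symbols)
    then have "t 0 \<in> ann_terms S D"
      using v plain_terms_subset[of S D] unfolding plain_terms_def ann_terms_def
      by (auto intro: terms_mono)
    moreover have "dp_at (t 0) [] = t 0"
      using flat_plain[OF v(1)] by (simp add: dp_at_def v(3))
    ultimately have "simulates S D (t 0) [] (u 0)"
      using v by (simp add: simulates_def u(1) sym_poss_def)
    then show "\<exists>z. simulates S D (fst z) (snd z) (u 0)" by auto
  next
    fix z k assume "simulates S D (fst z) (snd z) (u k)"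
    then have "\<exists>s' p' c. simulates S D s' p' (u (Suc k)) \<and> adp_rel S P c (fst z) s' \<and> (b k \<longrightarrow> c)"
      using simulate_dp[OF P' D_def] simulate_np[OF P' D_def] u(2)[of k]
      by (cases "b k") (simp; blast)+
    then show "\<exists>z'. simulates S D (fst z') (snd z') (u (Suc k)) \<and>
        (\<exists>c. adp_rel S P c (fst z) (fst z') \<and> (b k \<longrightarrow> c))"
      by auto
  qed
  then obtain z c where z: "\<And>k. simulates S D (fst (z k)) (snd (z k)) (u k)"
    and c: "\<And>k. adp_rel S P (c k) (fst (z k)) (fst (z (Suc k)))" "\<And>k. b k \<Longrightarrow> c k"
    by metis
  have "infinite {k. c k}" using inf c(2) by (metis (mono_tags) Collect_mono finite_subset)
  with c(1) z show ?thesis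
    by (intro infinite_path_not_AST[where s = "\<lambda>k. fst (z k)" and b = c]) (auto simp: simulates_def D_def)
qed

section \<open>Equivalence with termination of chains, and the processor\<close>

theorem theorem42:
  fixes S :: "('f, 'v) signature" and P :: "('f, 'v) adp set"
  assumes "finite (symbols S)"
    and "\<forall>\<alpha> \<in> P. \<exists>l r m. \<alpha> = (l, {#(1, r)#}, m)"
  shows
    "(adp_problem S P \<longrightarrow>
        (AST S P \<longleftrightarrow> dp_terminating S (defined P) (dp (defined P) P, np P)) \<and>
        (sound_on (AST S) proc_PR P \<and> complete_on (AST S) proc_PR P \<longleftrightarrow>
           dp_terminating S (defined P) (dp (defined P) P, np P))) \<and>
     (\<forall>I. basic_adp_problem S (I, P) \<longrightarrow>
        dp_terminating S (defined (I \<union> P)) (dp (defined (I \<union> P)) P, np P) \<longrightarrow>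
          bAST S (I, P) \<and>
          sound_on (bAST S) proc_PR (I, P) \<and> complete_on (bAST S) proc_PR (I, P))"
proof -
  have "AST S P \<longleftrightarrow> dp_terminating S (defined P) (dp (defined P) P, np P)" if "adp_problem S P"
  proof
    have adp: "\<forall>\<alpha> \<in> P. is_adp S (defined P) \<alpha>" using that by (simp add: adp_problem_def)
    show "dp_terminating S (defined P) (dp (defined P) P, np P)" if "AST S P"
      using dp_nonterminating_imp_not_AST[OF adp] that by blast
    show "AST S P" if "dp_terminating S (defined P) (dp (defined P) P, np P)"
      unfolding AST_def using chain_tree_leaf_prob[of S "{}" P] adp assms(2) that by simp
  qed
  moreover have "bAST S (I, P)" if "basic_adp_problem S (I, P)"
    "dp_terminating S (defined (I \<union> P)) (dp (defined (I \<union> P)) P, np P)" for I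
    unfolding bAST_def prod.case
  proof (intro allI impI, elim conjE)
    fix T rule
    assume "chain_tree S (I \<union> P) T rule" "finite {v \<in> inner T. rule v \<in> I - P}"
    then show "leaf_prob T = 1"
      using chain_tree_leaf_prob[of S I P] that assms(2) by (simp add: basic_adp_problem_def)
  qed
  \<comment> \<open>\<open>proc_PR\<close> returns no problems, so soundness means that the input
    has the property, and completeness is vacuous.\<close>
  ultimately show ?thesis
    by (simp add: sound_on_def complete_on_def proc_PR_def)
qed

end
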